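(* Consider the system $x(k+1)=A(k)x(k)+B(k)u(k)$, $x(0)=x_0\in\mathbb{R}^n$, composed of $N$ subsystems with the random matrices $A(k)$ satisfying the independence assumptions in the context. Suppose that for all $k$: $\mathbb{E}\{A(k)\}=\bar A\in\mathbb{R}^{n\times n}$, $\mathbb{E}\{A(k)\otimes A(k)\}=\Sigma\in\mathbb{R}^{n^2\times n^2}$, and $B(k)=B\in\mathbb{R}^{n\times m}$, with $\bar A,\Sigma,B$ independent of $k$. Suppose further that the system is mean square stabilizable under full model information (defined in the context). Let $Q\in\mathcal{S}_{++}^n$, $R=\mathrm{diag}(R_{11},\dots,R_{NN})\in\mathcal{S}_{++}^m$ with $R_{ii}\in\mathbb{R}^{m_i\times m_i}$, and $$J_\infty(x_0,\{u(k)\}_{k=0}^\infty)=\lim_{T\to\infty}\mathbb{E}\Big\{\sum_{k=0}^{T-1}\big(x(k)^\top Qx(k)+u(k)^\top Ru(k)\big)\Big\}.$$ Then the solution of the problem of minimizing $J_\infty$ over all control laws with full model information (defined in the context) is given by $$u(k)=-(R+B^\top PB)^{-1}B^\top PA(k)x(k),$$ where $P$ is the unique finite positive-definite solution of the modified discrete algebraic Riccati equation $$P=Q+\mathbf{R}(\bar A,P,B,R)+\sum_{i=1}^N\mathbb{E}\{\mathbf{R}(\tilde A_i(k),P,B,R)\}.$$ Furthermore, this controller mean square stabilizes the system (the closed-loop system is mean square stable), and $\inf_{\{u(k)\}_{k=0}^\infty}J_\infty(x_0,\{u(k)\}_{k=0}^\infty)=x_0^\top Px_0$, the infimum being over control laws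 with full model information.
   Context: Notation: $\mathcal{S}_{+}^n$ ($\mathcal{S}_{++}^n$) is the set of symmetric positive semidefinite (positive definite) matrices in $\mathbb{R}^{n\times n}$; $\otimes$ is the Kronecker product. The discrete Riccati operator is $\mathbf{R}(A,P,B,R)=A^\top(P-PB(R+B^\top PB)^{-1}B^\top P)A$ for $A\in\mathbb{R}^{n\times n}$, $P\in\mathcal{S}_+^n$, $B\in\mathbb{R}^{n\times m}$, $R\in\mathcal{S}_{++}^m$ (for any positive integers $n,m$). System: there are $N$ subsystems, subsystem $i$ having state $x_i(k)\in\mathbb{R}^{n_i}$, input $u_i(k)\in\mathbb{R}^{m_i}$ and dynamics $x_i(k+1)=\sum_{j=1}^N A_{ij}(k)x_j(k)+B_{ii}(k)u_i(k)$. Put $n=\sum_i n_i$, $m=\sum_i m_i$, $x(k)=[x_1(k)^\top\cdots x_N(k)^\top]^\top$, $u(k)=[u_1(k)^\top\cdots u_N(k)^\top]^\top$; then $x(k+1)=A(k)x(k)+B(k)u(k)$, with $A(k)=[A_{ij}(k)]_{i,j}$ and $B(k)=\mathrm{diag}(B_{11}(k),\dots,B_{NN}(k))$. The matrices $B_{ii}(k)$ and the initial state $x_0$ are deterministic; the $A_{ij}(k)\in\mathbb{R}^{n_i\times n_j}$ are random with finite first and second moments. Independence assumptions: the block rows $[A_{i1}(k)\;\cdots\;A_{iN}(k)]$, $1\le i\le N$, $k\ge0$, are mutually independent, both in time $k$ and across subsystems $i$ (blocks within the same block row at the same time may be dependent). Write $\tilde A_{ij}(k)=A_{ij}(k)-\mathbb{E}\{A_{ij}(k)\}$.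 $\tilde A_i(k)\in\mathbb{R}^{n\times n}$ has $i$-th block row $[\tilde A_{i1}(k)\;\cdots\;\tilde A_{iN}(k)]$ and all other block rows zero. Control laws with full model information: the design of each controller may use the exact realization of the whole matrix $A(k)$ together with the first- and second-order moments of the $A(k)$, and the controller measures the full state. That is, at each time $k$, $u_i(k)=\psi_i(A(k);x(0),\dots,x(k))$ for $1\le i\le N$, where $\psi_i$ (possibly depending on $k$) is an arbitrary measurable mapping into $\mathbb{R}^{m_i}$, not necessarily linear. A closed-loop system is mean square stable if $\lim_{k\to+\infty}\mathbb{E}\{x(k)^\top x(k)\}=0$ for every initial state $x_0$. The system is mean square stabilizable under full model information if there exists a (measurable) mapping $\Gamma:\mathbb{R}^{n\times n}\to\mathbb{R}^{m\times n}$ such that the closed-loop system with $u(k)=\Gamma(A(k))x(k)$ is mean square stable. *)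

theory Defs
  imports "HOL-Probability.Probability"
begin

text \<open>
  The index types \<open>'n\<close>, \<open>'m\<close>, \<open>'s\<close> number the coordinates of the global state, the coordinates
  of the global input, and the subsystems.  The partition into subsystems is a pair of surjections
  \<open>bx :: 'n \<Rightarrow> 's\<close> and \<open>bu :: 'm \<Rightarrow> 's\<close>: coordinate \<open>r\<close> belongs to \<open>bx r\<close>, so that
  \<open>n_i = card (bx -` {i})\<close> and \<open>m_i = card (bu -` {i})\<close>.
\<close>

definition pos_def :: "real^'n^'n \<Rightarrow> bool" where
  "pos_def X \<longleftrightarrow> transpose X = X \<and> (\<forall>v. v \<noteq> 0 \<longrightarrow> v \<bullet> (X *v v) > 0)"

definition block_diag :: "('n \<Rightarrow> 's) \<Rightarrow> ('m \<Rightarrow> 's) \<Rightarrow> real^'m^'n \<Rightarrow> bool" where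
  "block_diag f g X \<longleftrightarrow> (\<forall>r c. f r \<noteq> g c \<longrightarrow> X $ r $ c = 0)"

text \<open>Used both for vectors (\<open>'a = real\<close>) and for block rows of matrices (\<open>'a = real^'n\<close>);
  the entries outside block \<open>i\<close> are zero.\<close>

definition block :: "('k \<Rightarrow> 's) \<Rightarrow> 's \<Rightarrow> 'a::zero^'k \<Rightarrow> 'a^'k" where
  "block f i v = (\<chi> r. if f r = i then v $ r else 0)"

definition kronecker :: "real^'n^'m \<Rightarrow> real^'q^'p \<Rightarrow> real^('n \<times> 'q)^('m \<times> 'p)" where
  "kronecker X Y = (\<chi> r c. X $ fst r $ fst c * Y $ snd r $ snd c)"

definition riccati ::
  "real^'n^'n \<Rightarrow> real^'n^'n \<Rightarrow> real^'m^'n \<Rightarrow> real^'m^'m \<Rightarrow> real^'n^'n" where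
  "riccati A P B R =
     transpose A **
     (P - P ** B ** matrix_inv (R + transpose B ** P ** B) ** transpose B ** P) ** A"

text \<open>
  \<open>\<psi> k a xs\<close> is the stacked input at time \<open>k\<close>, given the realisation \<open>a\<close> of the matrix \<open>A(k)\<close> and
  the states \<open>xs 0, \<dots>, xs k\<close>; its block \<open>i\<close> is the law of subsystem \<open>i\<close>.
\<close>

type_synonym ('n, 'm) law = "nat \<Rightarrow> real^'n^'n \<Rightarrow> (nat \<Rightarrow> real^'n) \<Rightarrow> real^'m"

definition full_info_laws :: "('m::finite \<Rightarrow> 's) \<Rightarrow> ('n::finite, 'm) law set" where
  "full_info_laws bu =
     {\<psi>. \<forall>k i. (\<lambda>(a, xs). block bu i (\<psi> k a xs))
            \<in> borel_measurable (borel \<Otimes>\<^sub>M (\<Pi>\<^sub>M j\<in>{..k}. borel))}"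

definition feedback_law :: "(real^'n^'n \<Rightarrow> real^'n^'m) \<Rightarrow> ('n, 'm) law" where
  "feedback_law \<Gamma> = (\<lambda>k a xs. \<Gamma> a *v xs k)"

text \<open>Closed-loop trajectory along a realisation \<open>a 0, a 1, \<dots>\<close> of the random matrices.\<close>

lemma restrict_atMost_cong [fundef_cong]:
  assumes "k = l" and "\<And>j. j < Suc l \<Longrightarrow> f j = g j"
  shows "restrict f {..k} = restrict g {..l}"
  using assms by (auto simp: restrict_def fun_eq_iff)

fun state :: "(nat \<Rightarrow> real^'m^'n) \<Rightarrow> ('n, 'm) law \<Rightarrow> (nat \<Rightarrow> real^'n^'n) \<Rightarrow> real^'n
    \<Rightarrow> nat \<Rightarrow> real^'n" where
  "state B \<psi> a x0 0 = x0"
| "state B \<psi> a x0 (Suc k) =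
     a k *v state B \<psi> a x0 k + B k *v \<psi> k (a k) (\<lambda>j\<in>{..k}. state B \<psi> a x0 j)"

definition control :: "(nat \<Rightarrow> real^'m^'n) \<Rightarrow> ('n, 'm) law \<Rightarrow> (nat \<Rightarrow> real^'n^'n) \<Rightarrow> real^'n
    \<Rightarrow> nat \<Rightarrow> real^'m" where
  "control B \<psi> a x0 k = \<psi> k (a k) (\<lambda>j\<in>{..k}. state B \<psi> a x0 j)"

text \<open>Expectations of nonnegative quantities are taken in \<open>ennreal\<close>, so that a non-integrable
  quantity has expectation \<open>\<infinity>\<close> rather than the default value 0 of the Bochner integral.\<close>

definition ms_stable :: "'w measure \<Rightarrow> (nat \<Rightarrow> 'w \<Rightarrow> real^'n^'n) \<Rightarrow> (nat \<Rightarrow> real^'m^'n)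
    \<Rightarrow> ('n, 'm) law \<Rightarrow> bool" where
  "ms_stable M A B \<psi> \<longleftrightarrow>
     (\<forall>x0. (\<lambda>k. \<integral>\<^sup>+ \<omega>. ennreal (state B \<psi> (\<lambda>j. A j \<omega>) x0 k \<bullet> state B \<psi> (\<lambda>j. A j \<omega>) x0 k) \<partial>M)
            \<longlonglongrightarrow> 0)"

definition ms_stabilizable :: "'w measure \<Rightarrow> (nat \<Rightarrow> 'w \<Rightarrow> real^'n^'n) \<Rightarrow> (nat \<Rightarrow> real^'m^'n)
    \<Rightarrow> bool" where
  "ms_stabilizable M A B \<longleftrightarrow>
     (\<exists>\<Gamma> \<in> borel_measurable borel. ms_stable M A B (feedback_law \<Gamma>))"

text \<open>The sequence of finite-horizon costs is increasing, hence its limit exists in \<open>ennreal\<close>.\<close>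

definition J_inf :: "'w measure \<Rightarrow> (nat \<Rightarrow> 'w \<Rightarrow> real^'n^'n) \<Rightarrow> (nat \<Rightarrow> real^'m^'n)
    \<Rightarrow> real^'n^'n \<Rightarrow> real^'m^'m \<Rightarrow> real^'n \<Rightarrow> ('n, 'm) law \<Rightarrow> ennreal" where
  "J_inf M A B Q R x0 \<psi> =
     lim (\<lambda>T. \<integral>\<^sup>+ \<omega>. ennreal (\<Sum>k<T.
        (let x = state B \<psi> (\<lambda>j. A j \<omega>) x0 k; u = control B \<psi> (\<lambda>j. A j \<omega>) x0 k
         in x \<bullet> (Q *v x) + u \<bullet> (R *v u))) \<partial>M)"

definition mdare :: "'w measure \<Rightarrow> ('n \<Rightarrow> 's::finite) \<Rightarrow> (nat \<Rightarrow> 'w \<Rightarrow> real^'n^'n)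
    \<Rightarrow> real^'m^'n \<Rightarrow> real^'n^'n \<Rightarrow> real^'m^'m \<Rightarrow> nat \<Rightarrow> real^'n^'n \<Rightarrow> bool" where
  "mdare M bx A B Q R k P \<longleftrightarrow>
     P = Q + riccati (integral\<^sup>L M (A k)) P B R
         + (\<Sum>i\<in>UNIV. \<integral>\<omega>. riccati (block bx i (A k \<omega> - integral\<^sup>L M (A k))) P B R \<partial>M)"

definition lqr_gain :: "real^'m^'n \<Rightarrow> real^'m^'m \<Rightarrow> real^'n^'n \<Rightarrow> real^'n^'n \<Rightarrow> real^'n^'m" where
  "lqr_gain B R P a = - (matrix_inv (R + transpose B ** P ** B) ** transpose B ** P ** a)"

end

theory Submission
  imports Defs
begin

text \<open>
  The proof is dynamic programming with quadratic value functions.  Write \<open>K(P)\<close> for the matrix of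
  the quadratic form \<open>v \<mapsto> min\<^sub>u (u\<^sup>T R u + (v + B u)\<^sup>T P (v + B u))\<close> (\<open>stage_min\<close>; completing the
  square shows that it is the middle factor of the Riccati operator and that \<open>lqr_gain\<close> attains
  the minimum), and \<open>L(K)\<close> for the expectation of \<open>A(k)\<^sup>T K A(k)\<close>.  The map \<open>L\<close> is linear and
  positive, and it depends on \<open>k\<close> only through the second moments, hence not at all
  (\<open>moment_map\<close>).  Since distinct block rows are independent, their centred parts are
  uncorrelated, and the modified Riccati equation says exactly \<open>P = F(P)\<close> with
  \<open>F(P) = Q + L(K(P))\<close> (\<open>mdare_iff\<close>).

  The algebra uses only that \<open>F\<close> is monotone for the Loewner order and satisfies
  \<open>F(c P) \<le> c F(P) - (c - 1) Q\<close> for \<open>c \<ge> 1\<close>.  This makes a fixed point unique, since an inequality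
  \<open>P' \<le> c P\<close> between fixed points improves itself geometrically to \<open>P' \<le> P\<close> (\<open>fixed_point_le\<close>).
  It also shows that, if the increasing iterates \<open>F\<^sup>t(0)\<close> are bounded, a limit point of them is a
  fixed point (\<open>fixed_point_exists\<close>).

  Boundedness is where stabilizability enters.  The laws of the \<open>A(k)\<close> may vary with \<open>k\<close>, and a
  stabilising feedback may have infinite cost, or infinite second moments for a while, so its cost
  cannot serve as a bound.  Instead, if the iterates were unbounded, dividing them by
  their trace and passing to the limit would produce, for every \<open>k\<close>, a problem in which the
  control is free and only the state at time \<open>k\<close> is charged, but whose value is a matrix of trace
  one (\<open>unbounded_value_iter\<close>).  The second moments at time \<open>k\<close>, summed over the basis vectors as
  initial states, would then be bounded below independently of \<open>k\<close>, against mean square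
  stability (\<open>trace_value_iter_bounded\<close>).

  The probabilistic step is that the state at time \<open>k\<close> is independent of \<open>A(k)\<close>, which gives
  \<open>E (A x)\<^sup>T K (A x) = E x\<^sup>T L(K) x\<close> for any measurable law (\<open>expected_next_stage\<close>).  Summing over
  the stages, every law costs at least \<open>x\<^sub>0\<^sup>T F\<^sup>t(0) x\<^sub>0\<close> up to time \<open>t\<close>, hence at least
  \<open>x\<^sub>0\<^sup>T P x\<^sub>0\<close> altogether, while for the Riccati feedback the inequality becomes an equality with
  terminal charge \<open>P\<close>.  Under that feedback \<open>E x\<^sup>T P x\<close> contracts by a fixed factor, because
  \<open>L(K(P)) = P - Q\<close>; this is mean square stability.
\<close>

section \<open>Quadratic forms and the Loewner order\<close>

text \<open>The quadratic form of a matrix.  The Loewner order \<open>X \<le> Y\<close> is expressed throughout by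
  \<open>\<And>v. quad X v \<le> quad Y v\<close>.\<close>

abbreviation quad :: "real^'n^'n \<Rightarrow> real^'n \<Rightarrow> real" where
  "quad X v \<equiv> v \<bullet> (X *v v)"

text \<open>As for \<open>pos_def\<close>, symmetry is part of the notion.\<close>

definition pos_semidef :: "real^'n^'n \<Rightarrow> bool" where
  "pos_semidef X \<longleftrightarrow> transpose X = X \<and> (\<forall>v. 0 \<le> quad X v)"

lemma inner_matrix_vector_mult:
  fixes X :: "real^'n^'m"
  shows "x \<bullet> (X *v y) = (transpose X *v x) \<bullet> y"
  by (simp add: dot_lmul_matrix)

lemma inner_symmetric_matrix:
  fixes X :: "real^'n^'n"
  assumes "transpose X = X"
  shows "x \<bullet> (X *v y) = y \<bullet> (X *v x)"
  by (metis assms inner_commute inner_matrix_vector_mult)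

lemma quad_add: "quad (X + Y) v = quad X v + quad Y v"
  by (simp add: matrix_vector_mult_add_rdistrib inner_add_right)

lemma quad_diff: "quad (X - Y) v = quad X v - quad Y v"
  by (simp add: matrix_vector_mult_diff_rdistrib inner_diff_right)

lemma quad_scaleR: "quad (c *\<^sub>R X) v = c * quad X v"
  by (simp add: scaleR_matrix_vector_assoc [symmetric])

lemma quad_zero [simp]: "quad 0 v = 0"
  by (simp add: matrix_vector_mult_def inner_vec_def)

lemma uminus_matrix_vector_mult: "(- X) *v v = - (X *v v)" for X :: "real^'n^'m"
  by (simp add: matrix_vector_mult_def vec_eq_iff sum_negf)

lemma quad_eq_sum: "quad X v = (\<Sum>r\<in>UNIV. \<Sum>s\<in>UNIV. X $ r $ s * (v $ r * v $ s))"
  by (simp add: inner_vec_def matrix_vector_mult_def sum_distrib_left mult_ac)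

lemma quad_congruence: "quad (transpose Y ** X ** Y) v = quad X (Y *v v)"
  by (metis inner_matrix_vector_mult matrix_vector_mul_assoc transpose_transpose)

lemma quad_axis: "quad X (axis i 1) = X $ i $ i"
  by (simp add: inner_axis' matrix_vector_mult_basis column_def)

lemma quad_add_vector:
  assumes "transpose X = X"
  shows "quad X (v + w) = quad X v + 2 * (v \<bullet> (X *v w)) + quad X w"
  using inner_symmetric_matrix [OF assms, of v w]
  by (simp add: matrix_vector_right_distrib inner_add_left inner_add_right)

lemma quad_diff_vector:
  assumes "transpose X = X"
  shows "quad X (v - w) = quad X v - 2 * (v \<bullet> (X *v w)) + quad X w"
  using inner_symmetric_matrix [OF assms, of v w]
  by (simp add: matrix_vector_mult_diff_distrib inner_diff_left inner_diff_right)

lemma transpose_add: "transpose (X + Y) = transpose X + transpose Y"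
  by (simp add: transpose_def vec_eq_iff)

lemma transpose_diff: "transpose (X - Y) = transpose X - transpose Y"
  by (simp add: transpose_def vec_eq_iff)

lemma symmetric_eqI:
  fixes X Y :: "real^'n^'n"
  assumes X: "transpose X = X" and Y: "transpose Y = Y" and eq: "\<And>v. quad X v = quad Y v"
  shows "X = Y"
proof -
  have entry: "axis i 1 \<bullet> (Z *v axis j 1) = Z $ i $ j" for Z :: "real^'n^'n" and i j
    by (simp add: inner_axis' matrix_vector_mult_basis column_def)
  have "X $ i $ j = Y $ i $ j" for i j
    using quad_add_vector [OF X, of "axis i 1" "axis j 1"]
      quad_add_vector [OF Y, of "axis i 1" "axis j 1"]
    by (simp add: eq entry)
  then show ?thesis
    by (simp add: vec_eq_iff)
qed

lemma pos_semidef_sym: "pos_semidef X \<Longrightarrow> transpose X = X"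
  by (simp add: pos_semidef_def)

lemma pos_semidef_ge_0: "pos_semidef X \<Longrightarrow> 0 \<le> quad X v"
  by (simp add: pos_semidef_def)

lemma pos_def_imp_pos_semidef: "pos_def X \<Longrightarrow> pos_semidef X"
  unfolding pos_def_def pos_semidef_def by (metis inner_zero_left less_eq_real_def)

lemma pos_semidef_zero: "pos_semidef 0"
  by (simp add: pos_semidef_def transpose_def vec_eq_iff)

lemma pos_semidef_scaleR: "0 \<le> c \<Longrightarrow> pos_semidef X \<Longrightarrow> pos_semidef (c *\<^sub>R X)"
  by (simp add: pos_semidef_def transpose_scalar quad_scaleR)

lemma pos_def_add_pos_semidef:
  assumes "pos_def X" "pos_semidef Y"
  shows "pos_def (X + Y)"
  using assms by (simp add: pos_def_def pos_semidef_def transpose_add quad_add add_pos_nonneg)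

lemma pos_semidef_congruence:
  assumes "pos_semidef X"
  shows "pos_semidef (transpose Y ** X ** Y)"
  using assms
  by (simp add: pos_semidef_def quad_congruence matrix_transpose_mul matrix_mul_assoc)

text \<open>Since the dimension is finite, the trace bounds a positive semidefinite matrix entrywise,
  hence also its norm and its quadratic form.\<close>

lemma pos_semidef_entry_le_trace:
  assumes X: "pos_semidef X"
  shows "\<bar>X $ i $ j\<bar> \<le> trace X"
proof -
  have diag: "0 \<le> X $ l $ l" for l
    using pos_semidef_ge_0 [OF X, of "axis l 1"] by (simp add: quad_axis)
  have le: "X $ l $ l \<le> trace X" for l
    unfolding trace_def by (rule member_le_sum) (simp_all add: diag)
  have entry: "axis i 1 \<bullet> (X *v axis j 1) = X $ i $ j"
    by (simp add: inner_axis' matrix_vector_mult_basis column_def)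
  have "0 \<le> X $ i $ i + 2 * X $ i $ j + X $ j $ j"
    using quad_add_vector [OF pos_semidef_sym [OF X], of "axis i 1" "axis j 1"]
      pos_semidef_ge_0 [OF X, of "axis i 1 + axis j 1"]
    by (simp add: quad_axis entry)
  moreover have "0 \<le> X $ i $ i - 2 * X $ i $ j + X $ j $ j"
    using quad_diff_vector [OF pos_semidef_sym [OF X], of "axis i 1" "axis j 1"]
      pos_semidef_ge_0 [OF X, of "axis i 1 - axis j 1"]
    by (simp add: quad_axis entry)
  ultimately show ?thesis
    using le [of i] le [of j] by linarith
qed

lemma pos_semidef_trace_ge_0: "pos_semidef X \<Longrightarrow> 0 \<le> trace X"
  using pos_semidef_entry_le_trace [of X undefined undefined] by linarith

lemma quad_le_of_entries:
  fixes X :: "real^'n^'n"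
  assumes "\<And>i j. \<bar>X $ i $ j\<bar> \<le> c"
  shows "quad X v \<le> real CARD('n)^2 * c * (v \<bullet> v)"
proof -
  have "X $ r $ s * (v $ r * v $ s) \<le> c * (v \<bullet> v)" for r s
  proof -
    have "\<bar>v $ r\<bar> \<le> norm v" "\<bar>v $ s\<bar> \<le> norm v"
      by (simp_all add: component_le_norm_cart)
    then have "\<bar>v $ r\<bar> * \<bar>v $ s\<bar> \<le> norm v * norm v"
      by (intro mult_mono) auto
    moreover have "0 \<le> c"
      using assms [of r s] by linarith
    ultimately have "\<bar>X $ r $ s\<bar> * (\<bar>v $ r\<bar> * \<bar>v $ s\<bar>) \<le> c * (norm v * norm v)"
      using mult_mono [OF assms [of r s]] by simp
    also have "\<bar>X $ r $ s\<bar> * (\<bar>v $ r\<bar> * \<bar>v $ s\<bar>) = \<bar>X $ r $ s * (v $ r * v $ s)\<bar>"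
      by (simp add: abs_mult)
    finally show ?thesis
      by (simp add: dot_square_norm power2_eq_square)
  qed
  then have "quad X v \<le> (\<Sum>r\<in>(UNIV :: 'n set). \<Sum>s\<in>(UNIV :: 'n set). c * (v \<bullet> v))"
    unfolding quad_eq_sum by (intro sum_mono)
  then show ?thesis
    by (simp add: power2_eq_square mult_ac)
qed

lemma norm_matrix_le_of_entries:
  fixes X :: "real^'n^'m"
  assumes "\<And>i j. \<bar>X $ i $ j\<bar> \<le> c"
  shows "norm X \<le> real CARD('m) * (real CARD('n) * c)"
proof -
  have "norm (X $ i) \<le> real CARD('n) * c" for i
  proof -
    have "norm (X $ i) \<le> (\<Sum>j\<in>UNIV. \<bar>X $ i $ j\<bar>)"
      by (rule norm_le_l1_cart)
    also have "\<dots> \<le> (\<Sum>j\<in>(UNIV :: 'n set). c)"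
      by (intro sum_mono assms)
    finally show ?thesis by simp
  qed
  moreover have "norm X \<le> (\<Sum>i\<in>UNIV. norm (X $ i))"
    unfolding norm_vec_def by (rule L2_set_le_sum) simp
  ultimately show ?thesis
    using sum_mono [of UNIV "\<lambda>i. norm (X $ i)" "\<lambda>_. real CARD('n) * c"] by force
qed

lemma pos_def_lower_bound:
  fixes X :: "real^'n^'n"
  assumes "pos_def X"
  obtains c where "0 < c" "\<And>v. c * (v \<bullet> v) \<le> quad X v"
proof -
  have "continuous_on (sphere 0 1) (quad X)"
    by (intro continuous_intros linear_continuous_on_compose [OF _ matrix_vector_mul_linear])
  moreover have "sphere 0 1 \<noteq> ({} :: (real^'n) set)" "compact (sphere 0 (1::real) :: (real^'n) set)"
    by simp_all
  ultimately obtain w where w: "w \<in> sphere 0 1" "\<And>v. v \<in> sphere 0 1 \<Longrightarrow> quad X w \<le> quad X v"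
    using continuous_attains_inf [of "sphere 0 1" "quad X"] by blast
  have "w \<noteq> 0" using w(1) by auto
  then have "0 < quad X w"
    using assms by (simp add: pos_def_def)
  moreover have "quad X w * (v \<bullet> v) \<le> quad X v" for v
  proof (cases "v = 0")
    case False
    have "quad X w \<le> quad X ((1 / norm v) *\<^sub>R v)"
      using w(2) [of "(1 / norm v) *\<^sub>R v"] False by simp
    also have "\<dots> = quad X v / (v \<bullet> v)"
      by (simp add: matrix_vector_mult_scaleR dot_square_norm power2_eq_square)
    finally show ?thesis
      using False by (simp add: field_simps)
  qed simp
  ultimately show ?thesis by (rule that)
qed

lemma pos_def_dominates:
  fixes X Y :: "real^'n^'n"
  assumes X: "pos_semidef X" and Y: "pos_def Y"
  obtains c where "1 \<le> c" "\<And>v. quad X v \<le> c * quad Y v"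
proof -
  obtain d where d: "0 < d" "\<And>v. d * (v \<bullet> v) \<le> quad Y v"
    using pos_def_lower_bound [OF Y] by blast
  define b where "b = real CARD('n)^2 * trace X"
  have b: "0 \<le> b"
    using pos_semidef_trace_ge_0 [OF X] by (simp add: b_def)
  have "quad X v \<le> (b / d + 1) * quad Y v" for v
  proof -
    have "quad X v \<le> b * (v \<bullet> v)"
      unfolding b_def by (intro quad_le_of_entries pos_semidef_entry_le_trace X)
    also have "\<dots> = b / d * (d * (v \<bullet> v))"
      using d(1) by simp
    also have "\<dots> \<le> b / d * quad Y v"
      using b d by (intro mult_left_mono) auto
    also have "\<dots> \<le> (b / d + 1) * quad Y v"
      using pos_semidef_ge_0 [OF pos_def_imp_pos_semidef [OF Y], of v] by (simp add: distrib_right)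
    finally show ?thesis .
  qed
  then show ?thesis
    using b d by (intro that [of "b / d + 1"]) auto
qed

lemma pos_def_matrix_inv:
  fixes X :: "real^'n^'n"
  assumes "pos_def X"
  shows "X ** matrix_inv X = mat 1" "transpose (matrix_inv X) = matrix_inv X"
proof -
  have "v = 0" if "X *v v = 0" for v
  proof (rule ccontr)
    assume "v \<noteq> 0"
    then have "0 < quad X v" using assms by (simp add: pos_def_def)
    then show False using that by simp
  qed
  then have "invertible X"
    by (simp add: invertible_left_inverse matrix_left_invertible_ker)
  then have inv: "X ** matrix_inv X = mat 1 \<and> matrix_inv X ** X = mat 1"
    unfolding matrix_inv_def invertible_def by (rule someI_ex)
  then show "X ** matrix_inv X = mat 1" by simp
  have "transpose (matrix_inv X) ** X = mat 1"
    using inv assms by (metis matrix_transpose_mul pos_def_def transpose_mat)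
  then show "transpose (matrix_inv X) = matrix_inv X"
    using inv by (metis matrix_mul_assoc matrix_mul_lid matrix_mul_rid)
qed

section \<open>Minimising one stage\<close>

text \<open>The minimum over \<open>u\<close> of \<open>quad R u + quad P (v + B *v u)\<close> is again a quadratic form in \<open>v\<close>,
  and this is its matrix.\<close>

definition stage_min :: "real^'n^'n \<Rightarrow> real^'m^'n \<Rightarrow> real^'m^'m \<Rightarrow> real^'n^'n" where
  "stage_min P B R = P - P ** B ** matrix_inv (R + transpose B ** P ** B) ** transpose B ** P"

lemma riccati_eq: "riccati A P B R = transpose A ** stage_min P B R ** A"
  by (simp add: riccati_def stage_min_def)

text \<open>The gain for the realisation \<open>a\<close> is a fixed matrix, \<open>lqr_gain B R P (mat 1)\<close>, applied after
  \<open>a\<close>.\<close>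

lemma lqr_gain_apply: "lqr_gain B R P a *v x = lqr_gain B R P (mat 1) *v (a *v x)"
  by (simp only: lqr_gain_def uminus_matrix_vector_mult matrix_vector_mul_assoc [symmetric]
      matrix_vector_mul_lid)

lemma complete_the_square:
  fixes B :: "real^'m^'n"
  assumes P: "pos_semidef P" and R: "pos_def R"
  shows "quad R u + quad P (v + B *v u) =
    quad (stage_min P B R) v
      + quad (R + transpose B ** P ** B) (u - lqr_gain B R P (mat 1) *v v)"
proof -
  define S where "S = R + transpose B ** P ** B"
  define G where "G = matrix_inv S ** transpose B ** P"
  have S: "pos_def S"
    unfolding S_def by (intro pos_def_add_pos_semidef R pos_semidef_congruence P)
  then have S_sym: "transpose S = S" by (simp add: pos_def_def)
  have gain: "lqr_gain B R P (mat 1) = - G"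
    by (simp add: lqr_gain_def G_def S_def)
  have SG: "S ** G = transpose B ** P"
    by (simp add: G_def matrix_mul_assoc pos_def_matrix_inv [OF S])
  have cross: "w \<bullet> (S *v (G *v v)) = (B *v w) \<bullet> (P *v v)" for w
  proof -
    have "w \<bullet> (S *v (G *v v)) = w \<bullet> (transpose B *v (P *v v))"
      by (simp only: matrix_vector_mul_assoc SG)
    then show ?thesis
      by (metis inner_matrix_vector_mult transpose_transpose)
  qed
  have "stage_min P B R = P - P ** B ** G"
    by (simp add: stage_min_def G_def S_def matrix_mul_assoc)
  then have "quad (stage_min P B R) v = quad P v - v \<bullet> (P *v (B *v (G *v v)))"
    by (simp only: quad_diff) (simp add: matrix_vector_mul_assoc matrix_mul_assoc)
  also have "v \<bullet> (P *v (B *v (G *v v))) = quad S (G *v v)"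
    by (simp only: cross inner_symmetric_matrix [OF pos_semidef_sym [OF P], of v])
  finally have min: "quad (stage_min P B R) v = quad P v - quad S (G *v v)" .
  have "quad S (u - lqr_gain B R P (mat 1) *v v) = quad S (u + G *v v)"
    by (simp only: gain) (simp add: uminus_matrix_vector_mult)
  also have "\<dots> = quad S u + 2 * ((B *v u) \<bullet> (P *v v)) + quad S (G *v v)"
    by (simp only: quad_add_vector [OF S_sym] cross)
  also have "quad S u = quad R u + quad P (B *v u)"
    by (simp only: S_def quad_add quad_congruence)
  also have "(B *v u) \<bullet> (P *v v) = v \<bullet> (P *v (B *v u))"
    by (rule inner_symmetric_matrix [OF pos_semidef_sym [OF P]])
  finally show ?thesis
    by (simp only: S_def [symmetric] min quad_add_vector [OF pos_semidef_sym [OF P]])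
qed

lemma stage_min_le:
  assumes "pos_semidef P" "pos_def R"
  shows "quad (stage_min P B R) v \<le> quad R u + quad P (v + B *v u)"
proof -
  have "pos_semidef (R + transpose B ** P ** B)"
    by (rule pos_def_imp_pos_semidef) (intro pos_def_add_pos_semidef pos_semidef_congruence assms)
  then show ?thesis
    unfolding complete_the_square [OF assms] by (simp add: pos_semidef_ge_0)
qed

lemma stage_min_attained:
  assumes "pos_semidef P" "pos_def R" "u = lqr_gain B R P (mat 1) *v v"
  shows "quad R u + quad P (v + B *v u) = quad (stage_min P B R) v"
  unfolding complete_the_square [OF assms(1,2)] by (simp add: assms(3))

lemma pos_semidef_stage_min:
  assumes P: "pos_semidef P" and R: "pos_def R"
  shows "pos_semidef (stage_min P B R)"
proof -
  have S: "pos_def (R + transpose B ** P ** B)"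
    using P R by (intro pos_def_add_pos_semidef pos_semidef_congruence)
  have "0 \<le> quad (stage_min P B R) v" for v
    unfolding stage_min_attained [OF P R refl, symmetric]
    by (intro add_nonneg_nonneg pos_semidef_ge_0 P pos_def_imp_pos_semidef [OF R])
  moreover have "transpose (stage_min P B R) = stage_min P B R"
    by (simp add: stage_min_def transpose_diff matrix_transpose_mul pos_def_matrix_inv(2) [OF S]
        pos_semidef_sym [OF P] matrix_mul_assoc)
  ultimately show ?thesis
    by (simp add: pos_semidef_def)
qed

lemma stage_min_mono:
  assumes "pos_semidef P" "pos_semidef P'" "pos_def R" and le: "\<And>v. quad P v \<le> quad P' v"
  shows "quad (stage_min P B R) v \<le> quad (stage_min P' B R) v"
proof -
  define u where "u = lqr_gain B R P' (mat 1) *v v"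
  have "quad (stage_min P B R) v \<le> quad R u + quad P (v + B *v u)"
    by (rule stage_min_le [OF assms(1,3)])
  also have "\<dots> \<le> quad R u + quad P' (v + B *v u)"
    by (simp add: le)
  also have "\<dots> = quad (stage_min P' B R) v"
    by (rule stage_min_attained [OF assms(2,3) u_def])
  finally show ?thesis .
qed

lemma stage_min_scaleR_le:
  assumes P: "pos_semidef P" and R: "pos_def R" and c: "1 \<le> c"
  shows "quad (stage_min (c *\<^sub>R P) B R) v \<le> c * quad (stage_min P B R) v"
proof -
  define u where "u = lqr_gain B R P (mat 1) *v v"
  have "quad (stage_min (c *\<^sub>R P) B R) v \<le> quad R u + quad (c *\<^sub>R P) (v + B *v u)"
    using P c by (intro stage_min_le R pos_semidef_scaleR) auto
  also have "\<dots> \<le> c * quad R u + c * quad P (v + B *v u)"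
    using c pos_semidef_ge_0 [OF pos_def_imp_pos_semidef [OF R], of u]
    by (simp add: quad_scaleR mult_le_cancel_right1)
  also have "\<dots> = c * quad (stage_min P B R) v"
    by (simp add: stage_min_attained [OF P R u_def, symmetric] distrib_left)
  finally show ?thesis .
qed

section \<open>The Riccati map and its value iteration\<close>

lemma trace_scaleR: "trace (c *\<^sub>R X) = c * trace (X :: real^'n^'n)"
  by (simp add: trace_def sum_distrib_left)

lemma trace_mono:
  fixes X Y :: "real^'n^'n"
  assumes "\<And>v. quad X v \<le> quad Y v"
  shows "trace X \<le> trace Y"
  unfolding trace_def by (intro sum_mono) (metis assms quad_axis)

lemma tendsto_quad:
  fixes X :: "'a \<Rightarrow> real^'n^'n"
  assumes "(X \<longlongrightarrow> Y) F"
  shows "((\<lambda>t. quad (X t) v) \<longlongrightarrow> quad Y v) F"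
  unfolding quad_eq_sum by (intro tendsto_intros tendsto_vec_nth assms)

lemma pos_semidef_limit:
  fixes X :: "nat \<Rightarrow> real^'n^'n"
  assumes lim: "X \<longlonglongrightarrow> Y" and X: "\<And>t. pos_semidef (X t)"
  shows "pos_semidef Y"
proof -
  have "Y $ i $ j = Y $ j $ i" for i j
  proof (rule LIMSEQ_unique)
    show "(\<lambda>t. X t $ i $ j) \<longlonglongrightarrow> Y $ i $ j"
      by (intro tendsto_vec_nth lim)
    have "X t $ i $ j = X t $ j $ i" for t
      using pos_semidef_sym [OF X [of t]] by (simp add: transpose_def vec_eq_iff)
    then show "(\<lambda>t. X t $ i $ j) \<longlonglongrightarrow> Y $ j $ i"
      by (simp add: tendsto_vec_nth lim)
  qed
  then have "transpose Y = Y"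
    by (simp add: transpose_def vec_eq_iff)
  moreover have "0 \<le> quad Y v" for v
    by (rule LIMSEQ_le_const [OF tendsto_quad [OF lim]]) (auto intro: pos_semidef_ge_0 X)
  ultimately show ?thesis
    by (simp add: pos_semidef_def)
qed

lemma common_convergent_subsequence:
  fixes f :: "nat \<Rightarrow> nat \<Rightarrow> 'a::heine_borel"
  assumes "\<And>j. bounded (range (f j))"
  shows "\<exists>r. strict_mono r \<and> (\<forall>j\<le>k. convergent (f j \<circ> r))"
proof (induction k)
  case 0
  show ?case
    using bounded_imp_convergent_subsequence [OF assms [of 0]] by (auto simp: convergent_def o_def)
next
  case (Suc k)
  then obtain r where r: "strict_mono r" "\<And>j. j \<le> k \<Longrightarrow> convergent (f j \<circ> r)"
    by blast
  have "bounded (range (f (Suc k) \<circ> r))"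
    by (rule bounded_subset [OF assms [of "Suc k"]]) auto
  then obtain l s where s: "strict_mono s" "((f (Suc k) \<circ> r) \<circ> s) \<longlonglongrightarrow> l"
    using bounded_imp_convergent_subsequence by blast
  have "convergent (f j \<circ> (r \<circ> s))" if "j \<le> Suc k" for j
  proof (cases "j = Suc k")
    case True
    then show ?thesis
      using s(2) by (auto simp: convergent_def o_assoc)
  next
    case False
    then show ?thesis
      using that convergent_subseq_convergent [OF r(2) s(1), of j] by (simp add: o_assoc)
  qed
  then show ?case
    using strict_mono_o [OF r(1) s(1)] by blast
qed

text \<open>The modified Riccati equation is the fixed-point equation of
  \<open>P \<mapsto> Q + L (stage_min P B R)\<close>, where \<open>L K\<close> stands for the expectation of
  \<open>transpose A ** K ** A\<close>.  Only linearity and positivity of \<open>L\<close> matter for the algebraic part.\<close>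

locale riccati_map =
  fixes L :: "real^'n^'n \<Rightarrow> real^'n^'n" and Q :: "real^'n^'n"
    and B :: "real^'m^'n" and R :: "real^'m^'m"
  assumes linear_L: "linear L"
    and pos_semidef_L: "pos_semidef K \<Longrightarrow> pos_semidef (L K)"
    and pos_def_Q: "pos_def Q" and pos_def_R: "pos_def R"
begin

text \<open>The right-hand side of the modified Riccati equation.\<close>

definition riccati_step :: "real^'n^'n \<Rightarrow> real^'n^'n" where
  "riccati_step P = Q + L (stage_min P B R)"

text \<open>\<open>value_iter t\<close> is the matrix of the optimal cost over \<open>t\<close> stages.\<close>

definition value_iter :: "nat \<Rightarrow> real^'n^'n" where
  "value_iter t = (riccati_step ^^ t) 0"

lemma value_iter_0 [simp]: "value_iter 0 = 0"
  and value_iter_Suc: "value_iter (Suc t) = riccati_step (value_iter t)"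
  by (simp_all add: value_iter_def)

lemma L_mono:
  assumes X: "pos_semidef X" and Y: "pos_semidef Y" and le: "\<And>v. quad X v \<le> quad Y v"
  shows "quad (L X) v \<le> quad (L Y) v"
proof -
  have "pos_semidef (Y - X)"
    using pos_semidef_sym [OF X] pos_semidef_sym [OF Y] le
    by (simp add: pos_semidef_def transpose_diff quad_diff)
  then have "0 \<le> quad (L (Y - X)) v"
    by (intro pos_semidef_ge_0 pos_semidef_L)
  then show ?thesis
    by (simp add: linear_diff [OF linear_L] quad_diff)
qed

lemma pos_def_riccati_step: "pos_semidef P \<Longrightarrow> pos_def (riccati_step P)"
  unfolding riccati_step_def
  by (intro pos_def_add_pos_semidef pos_def_Q pos_semidef_L pos_semidef_stage_min pos_def_R)

lemma riccati_step_mono: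
  assumes "pos_semidef P" "pos_semidef P'" and "\<And>v. quad P v \<le> quad P' v"
  shows "quad (riccati_step P) v \<le> quad (riccati_step P') v"
  unfolding riccati_step_def quad_add
  by (intro add_left_mono L_mono stage_min_mono pos_semidef_stage_min pos_def_R assms)

lemma riccati_step_scaleR_le:
  assumes P: "pos_semidef P" and c: "1 \<le> c"
  shows "quad (riccati_step (c *\<^sub>R P)) v \<le> c * quad (riccati_step P) v - (c - 1) * quad Q v"
proof -
  have "quad (L (stage_min (c *\<^sub>R P) B R)) v \<le> quad (L (c *\<^sub>R stage_min P B R)) v"
    using c stage_min_scaleR_le [OF P pos_def_R c]
    by (intro L_mono pos_semidef_stage_min pos_semidef_scaleR pos_def_R P) (auto simp: quad_scaleR)
  then show ?thesis
    by (simp add: riccati_step_def quad_add linear_scale [OF linear_L] quad_scaleR algebra_simps)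
qed

lemma pos_semidef_value_iter: "pos_semidef (value_iter t)"
  by (induction t) (simp_all add: pos_semidef_zero value_iter_Suc pos_def_riccati_step
      pos_def_imp_pos_semidef)

lemma value_iter_mono:
  assumes "s \<le> t"
  shows "quad (value_iter s) v \<le> quad (value_iter t) v"
proof -
  have step: "quad (value_iter t) v \<le> quad (value_iter (Suc t)) v" for t v
  proof (induction t arbitrary: v)
    case 0
    show ?case by (simp add: pos_semidef_value_iter pos_semidef_ge_0)
  next
    case (Suc t)
    have "quad (riccati_step (value_iter t)) v \<le> quad (riccati_step (value_iter (Suc t))) v"
      by (intro riccati_step_mono pos_semidef_value_iter Suc)
    then show ?case
      by (simp only: value_iter_Suc)
  qed
  show ?thesis
    by (rule lift_Suc_mono_le [of "\<lambda>t. quad (value_iter t) v", OF step assms])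
qed

lemma Q_le_value_iter:
  assumes "0 < t"
  shows "quad Q v \<le> quad (value_iter t) v"
proof -
  obtain s where t: "t = Suc s"
    using assms gr0_implies_Suc by blast
  have "0 \<le> quad (L (stage_min (value_iter s) B R)) v"
    by (intro pos_semidef_ge_0 pos_semidef_L pos_semidef_stage_min pos_semidef_value_iter pos_def_R)
  then show ?thesis
    by (simp add: t value_iter_Suc riccati_step_def quad_add)
qed

text \<open>If \<open>P' \<le> c *\<^sub>R P\<close> with \<open>c \<ge> 1\<close>, one application of the map improves the excess \<open>c - 1\<close> by a
  fixed factor \<open>1 - q\<close>, where \<open>q *\<^sub>R P \<le> Q\<close>.\<close>

lemma fixed_point_le:
  assumes P: "pos_semidef P" "riccati_step P = P" and P': "pos_semidef P'" "riccati_step P' = P'"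
  shows "quad P' v \<le> quad P v"
proof -
  have pd: "pos_def P"
    using pos_def_riccati_step [OF P(1)] by (simp add: P(2))
  obtain c where c: "1 \<le> c" "\<And>v. quad P' v \<le> c * quad P v"
    using pos_def_dominates [OF P'(1) pd] by blast
  obtain d where d: "1 \<le> d" "\<And>v. quad P v \<le> d * quad Q v"
    using pos_def_dominates [OF P(1) pos_def_Q] by blast
  \<comment> \<open>The largest multiple of \<open>P\<close> known to lie below \<open>Q\<close>; the excess \<open>c - 1\<close> shrinks by \<open>1 - q\<close>.\<close>
  define q where "q = 1 / d"
  have q: "0 < q" "q \<le> 1" "\<And>v. q * quad P v \<le> quad Q v"
    using d by (auto simp: q_def field_simps)
  have *: "quad P' v \<le> (1 + (c - 1) * (1 - q) ^ j) * quad P v" for j v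
  proof (induction j arbitrary: v)
    case 0
    show ?case using c(2) [of v] by simp
  next
    case (Suc j)
    define e where "e = (c - 1) * (1 - q) ^ j"
    have e: "0 \<le> e"
      using c(1) q(2) by (simp add: e_def)
    have psd: "pos_semidef ((1 + e) *\<^sub>R P)"
      using e P(1) by (intro pos_semidef_scaleR) auto
    have "quad P' v = quad (riccati_step P') v"
      by (simp add: P'(2))
    also have "\<dots> \<le> quad (riccati_step ((1 + e) *\<^sub>R P)) v"
      by (intro riccati_step_mono P' psd) (use Suc.IH in \<open>simp add: quad_scaleR e_def\<close>)
    also have "\<dots> \<le> (1 + e) * quad (riccati_step P) v - e * quad Q v"
      using riccati_step_scaleR_le [OF P(1), of "1 + e" v] e by simp
    also have "\<dots> \<le> (1 + e) * quad P v - e * (q * quad P v)"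
      using mult_left_mono [OF q(3) e, of v] by (simp add: P(2))
    also have "\<dots> = (1 + (c - 1) * (1 - q) ^ Suc j) * quad P v"
      by (simp add: e_def algebra_simps)
    finally show ?case .
  qed
  have "(\<lambda>j. (1 + (c - 1) * (1 - q) ^ j) * quad P v) \<longlonglongrightarrow> (1 + (c - 1) * 0) * quad P v"
    using q by (intro tendsto_intros LIMSEQ_realpow_zero) auto
  then show ?thesis
    using LIMSEQ_le_const [of _ "quad P v" "quad P' v"] * by auto
qed

lemma fixed_point_unique:
  assumes "pos_semidef P" "riccati_step P = P" "pos_semidef P'" "riccati_step P' = P'"
  shows "P' = P"
proof (rule symmetric_eqI)
  show "transpose P' = P'" "transpose P = P"
    by (simp_all add: assms pos_semidef_sym del: transpose_matrix_vector)
  show "quad P' v = quad P v" for v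
    by (rule antisym) (rule fixed_point_le; rule assms)+
qed

text \<open>A limit of value iterates is approximated by them multiplicatively, because they dominate
  \<open>Q\<close>.  Combined with the behaviour of the map under scaling, this makes the limit a fixed point
  without any continuity of the matrix inverse.\<close>

lemma fixed_point_exists:
  assumes bound: "\<And>t. trace (value_iter t) \<le> b"
  obtains P where "pos_def P" "riccati_step P = P"
    "\<And>d. 0 < d \<Longrightarrow> \<exists>t. \<forall>v. quad P v \<le> (1 + d) * quad (value_iter t) v"
proof -
  have "\<bar>value_iter t $ i $ j\<bar> \<le> b" for t i j
    using pos_semidef_entry_le_trace [OF pos_semidef_value_iter] bound by (rule order_trans)
  then have "bounded (range value_iter)"
    unfolding bounded_iff using norm_matrix_le_of_entries by blast
  then obtain P r where r: "strict_mono r" and lim: "(value_iter \<circ> r) \<longlonglongrightarrow> P"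
    using bounded_imp_convergent_subsequence by blast
  have psd: "pos_semidef P"
    by (rule pos_semidef_limit [OF lim]) (simp add: pos_semidef_value_iter)
  have le: "quad (value_iter t) v \<le> quad P v" for t v
  proof (rule LIMSEQ_le_const [OF tendsto_quad [OF lim]])
    have "quad (value_iter t) v \<le> quad ((value_iter \<circ> r) n) v" if "t \<le> n" for n
      using order_trans [OF that seq_suble [OF r]] by (simp add: value_iter_mono)
    then show "\<exists>N. \<forall>n\<ge>N. quad (value_iter t) v \<le> quad ((value_iter \<circ> r) n) v"
      by blast
  qed
  \<comment> \<open>An additive error becomes a multiplicative one, because all iterates but the first dominate
    the positive definite matrix \<open>Q\<close>.\<close>
  have approx: "\<exists>t. \<forall>v. quad P v \<le> (1 + d) * quad (value_iter t) v" if "0 < d" for d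
  proof -
    obtain q where q: "0 < q" "\<And>v. q * (v \<bullet> v) \<le> quad Q v"
      using pos_def_lower_bound [OF pos_def_Q] by blast
    define n where "n = real CARD('n)^2"
    have n: "0 < n" by (simp add: n_def)
    define e where "e = d * q / n"
    have "0 < e"
      using that q(1) n by (simp add: e_def)
    then have "eventually (\<lambda>t. dist ((value_iter \<circ> r) t) P < e) sequentially"
      by (rule tendstoD [OF lim])
    then have "eventually (\<lambda>t. 0 < t \<and> dist ((value_iter \<circ> r) t) P < e) sequentially"
      by (intro eventually_conj eventually_gt_at_top)
    then obtain t where t: "0 < t" "dist (value_iter (r t)) P < e"
      by (auto simp: eventually_sequentially)
    have rt: "0 < r t"
      using seq_suble [OF r, of t] t(1) by linarith
    have "\<bar>(P - value_iter (r t)) $ i $ j\<bar> \<le> e" for i j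
    proof -
      have "\<bar>(P - value_iter (r t)) $ i $ j\<bar> \<le> norm (P - value_iter (r t))"
        by (rule order_trans [OF component_le_norm_cart Finite_Cartesian_Product.norm_nth_le])
      then show ?thesis
        using t(2) by (simp add: dist_norm norm_minus_commute)
    qed
    then have "quad (P - value_iter (r t)) v \<le> n * e * (v \<bullet> v)" for v
      unfolding n_def by (rule quad_le_of_entries)
    moreover have "n * e * (v \<bullet> v) \<le> d * quad (value_iter (r t)) v" for v
    proof -
      have "n * e * (v \<bullet> v) = d * (q * (v \<bullet> v))"
        using n by (simp add: e_def)
      also have "\<dots> \<le> d * quad (value_iter (r t)) v"
        using that order_trans [OF q(2) Q_le_value_iter [OF rt]] by (intro mult_left_mono) auto
      finally show ?thesis .
    qed
    ultimately have "quad (P - value_iter (r t)) v \<le> d * quad (value_iter (r t)) v" for v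
      by (rule order_trans)
    then have "quad P v \<le> (1 + d) * quad (value_iter (r t)) v" for v
      by (simp add: quad_diff distrib_right diff_le_eq add.commute)
    then show ?thesis by blast
  qed
  have eq: "quad (riccati_step P) v = quad P v" for v
  proof (rule antisym)
    show "quad (riccati_step P) v \<le> quad P v"
    proof (rule field_le_epsilon)
      fix e :: real assume "0 < e"
      define d where "d = e / (quad P v + 1)"
      have d: "0 < d" "d * quad P v \<le> e"
        using \<open>0 < e\<close> pos_semidef_ge_0 [OF psd, of v] by (auto simp: d_def field_simps)
      obtain t where t: "\<And>v. quad P v \<le> (1 + d) * quad (value_iter t) v"
        using approx [OF d(1)] by blast
      have "quad (riccati_step P) v \<le> quad (riccati_step ((1 + d) *\<^sub>R value_iter t)) v"
        using d(1) t
        by (intro riccati_step_mono pos_semidef_scaleR pos_semidef_value_iter psd)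
          (auto simp: quad_scaleR)
      also have "\<dots> \<le> (1 + d) * quad (riccati_step (value_iter t)) v - d * quad Q v"
        using riccati_step_scaleR_le [OF pos_semidef_value_iter, where c = "1 + d"] d(1) by simp
      also have "\<dots> \<le> (1 + d) * quad (value_iter (Suc t)) v"
        using d(1) pos_semidef_ge_0 [OF pos_def_imp_pos_semidef [OF pos_def_Q], of v]
        by (simp add: value_iter_Suc)
      also have "\<dots> \<le> (1 + d) * quad P v"
        using d(1) le by (intro mult_left_mono) auto
      also have "\<dots> \<le> quad P v + e"
        using d(2) by (simp add: distrib_right)
      finally show "quad (riccati_step P) v \<le> quad P v + e" .
    qed
    have "quad (value_iter t) v \<le> quad (riccati_step P) v" for t
      using order_trans [OF value_iter_mono [of t "Suc t" v]]
        riccati_step_mono [OF pos_semidef_value_iter psd le, of v]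
      by (simp add: value_iter_Suc)
    then show "quad P v \<le> quad (riccati_step P) v"
      by (intro LIMSEQ_le_const2 [OF tendsto_quad [OF lim]]) auto
  qed
  have pd: "pos_def (riccati_step P)"
    by (rule pos_def_riccati_step [OF psd])
  have "riccati_step P = P"
    by (rule symmetric_eqI [OF pos_semidef_sym pos_semidef_sym eq])
      (simp_all add: psd pd pos_def_imp_pos_semidef)
  then show ?thesis
    using that [of P] pd approx by simp
qed

text \<open>If the iterates blow up, then after normalisation by the trace the control weight and the
  state weight disappear in the limit.  What remains is a terminal-cost problem over \<open>k\<close> stages
  in which the control is free, and whose optimal cost is bounded below by a matrix \<open>W 0\<close> of
  trace one.\<close>

lemma unbounded_value_iter:
  assumes unbounded: "\<And>b. \<exists>t. b < trace (value_iter t)"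
  shows "\<exists>W K. (\<forall>j. pos_semidef (W j)) \<and> (\<forall>j. pos_semidef (K j)) \<and>
    (\<forall>j<k. W j = L (K j) \<and> (\<forall>u v. quad (K j) v \<le> quad (W (Suc j)) (v + B *v u))) \<and>
    trace (W 0) = 1 \<and> (\<forall>v. quad (W k) v \<le> quad (W 0) v)"
proof -
  have "\<exists>s\<ge>k. real (Suc t) \<le> trace (value_iter s)" for t
  proof -
    obtain s where "real (Suc t) < trace (value_iter s)"
      using unbounded by blast
    also have "trace (value_iter s) \<le> trace (value_iter (max s k))"
      by (intro trace_mono value_iter_mono) simp
    finally show ?thesis
      by (intro exI [of _ "max s k"]) simp
  qed
  then obtain \<tau> where \<tau>: "\<And>t. k \<le> \<tau> t" "\<And>t. real (Suc t) \<le> trace (value_iter (\<tau> t))"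
    by metis
  define p where "p t = trace (value_iter (\<tau> t))" for t
  have p_ge: "real (Suc t) \<le> p t" for t
    unfolding p_def by (rule \<tau>(2))
  then have p_pos: "0 < p t" for t
    by (smt (verit) of_nat_0_less_iff zero_less_Suc)
  \<comment> \<open>All \<open>k + 1\<close> matrices are normalised by the same factor, so the recursion between them
    survives; time runs against the iteration index.\<close>
  define S where "S j t = (1 / p t) *\<^sub>R value_iter (\<tau> t - j)" for j t
  define K where "K j t = (1 / p t) *\<^sub>R stage_min (value_iter (\<tau> t - Suc j)) B R" for j t
  have psd_S: "pos_semidef (S j t)" for j t
    unfolding S_def using p_pos [of t] by (intro pos_semidef_scaleR pos_semidef_value_iter) simp
  have psd_K: "pos_semidef (K j t)" for j t
    unfolding K_def using p_pos [of t]
    by (intro pos_semidef_scaleR pos_semidef_stage_min pos_semidef_value_iter pos_def_R) simp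
  have trace_S: "trace (S j t) \<le> 1" for j t
  proof -
    have "trace (value_iter (\<tau> t - j)) \<le> p t"
      unfolding p_def by (intro trace_mono value_iter_mono) simp
    then show ?thesis
      using p_pos [of t] by (simp add: S_def trace_scaleR)
  qed
  have K_le: "quad (K j t) v \<le> quad R u / p t + quad (S (Suc j) t) (v + B *v u)" for j t u v
    using divide_right_mono [OF stage_min_le [OF pos_semidef_value_iter pos_def_R], where c = "p t"]
      p_pos [of t]
    by (simp add: K_def S_def quad_scaleR add_divide_distrib)
  have "trace (K j t) \<le> trace (S (Suc j) t)" for j t
    using K_le [where j = j and t = t and u = 0] by (intro trace_mono) simp
  then have trace_K: "trace (K j t) \<le> 1" for j t
    using trace_S order_trans by blast
  have entries: "\<bar>X $ i $ j\<bar> \<le> 1" if "pos_semidef X" "trace X \<le> 1" for X :: "real^'n^'n" and i j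
    using pos_semidef_entry_le_trace [OF that(1), of i j] that(2) by linarith
  have "bounded (range (\<lambda>t. (S j t, K j t)))" for j
  proof (rule boundedI)
    fix x assume "x \<in> range (\<lambda>t. (S j t, K j t))"
    then obtain t where x: "x = (S j t, K j t)" by blast
    have "norm x \<le> norm (S j t) + norm (K j t)"
      by (simp add: x norm_Pair_le)
    also have "\<dots> \<le> real CARD('n) * (real CARD('n) * 1) + real CARD('n) * (real CARD('n) * 1)"
      by (intro add_mono norm_matrix_le_of_entries entries psd_S psd_K trace_S trace_K)
    finally show "norm x \<le> \<dots>" .
  qed
  then obtain r where r: "strict_mono r"
    and conv: "\<And>j. j \<le> k \<Longrightarrow> convergent ((\<lambda>t. (S j t, K j t)) \<circ> r)"
    using common_convergent_subsequence [of "\<lambda>j t. (S j t, K j t)" k] by blast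
  have "\<exists>W K'. j \<le> k \<longrightarrow> (S j \<circ> r) \<longlonglongrightarrow> W \<and> (K j \<circ> r) \<longlonglongrightarrow> K'" for j
  proof (cases "j \<le> k")
    case True
    then obtain l where l: "(\<lambda>t. (S j (r t), K j (r t))) \<longlonglongrightarrow> l"
      using conv [OF True] unfolding convergent_def o_def by blast
    show ?thesis
      using tendsto_fst [OF l] tendsto_snd [OF l] by (auto simp: o_def)
  qed simp
  then obtain W K' where lim: "\<And>j. j \<le> k \<Longrightarrow> (S j \<circ> r) \<longlonglongrightarrow> W j" "\<And>j. j \<le> k \<Longrightarrow> (K j \<circ> r) \<longlonglongrightarrow> K' j"
    by metis
  have p_lim: "(\<lambda>t. c / p (r t)) \<longlonglongrightarrow> 0" for c
  proof -
    have "filterlim (\<lambda>t. real (Suc t)) at_top sequentially"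
      by (rule filterlim_compose [OF filterlim_real_sequentially filterlim_Suc])
    then have "filterlim p at_top sequentially"
      by (rule filterlim_at_top_mono) (intro always_eventually allI p_ge)
    then have "(\<lambda>t. c / p t) \<longlonglongrightarrow> 0"
      by (rule real_tendsto_divide_at_top [OF tendsto_const])
    then show ?thesis
      using LIMSEQ_subseq_LIMSEQ [OF _ r] by (auto simp: o_def)
  qed
  have psd_W: "pos_semidef (W j)" "pos_semidef (K' j)" if "j \<le> k" for j
    using pos_semidef_limit [OF lim(1) [OF that]] pos_semidef_limit [OF lim(2) [OF that]]
    by (simp_all add: psd_S psd_K)
  have W_eq: "W j = L (K' j)" if "j < k" for j
  proof (rule LIMSEQ_unique)
    show "(S j \<circ> r) \<longlonglongrightarrow> W j"
      using that by (intro lim) simp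
    have "S j t = (1 / p t) *\<^sub>R Q + L (K j t)" for t
    proof -
      have "\<tau> t - j = Suc (\<tau> t - Suc j)"
        using that \<tau>(1) [of t] by simp
      then show ?thesis
        by (simp add: S_def K_def value_iter_Suc riccati_step_def linear_scale [OF linear_L]
            scaleR_add_right)
    qed
    moreover have "(\<lambda>t. (1 / p (r t)) *\<^sub>R Q + L (K j (r t))) \<longlonglongrightarrow> 0 *\<^sub>R Q + L (K' j)"
    proof (intro tendsto_intros p_lim)
      have "bounded_linear L"
        by (simp add: linear_L linear_conv_bounded_linear [symmetric])
      then show "(\<lambda>t. L (K j (r t))) \<longlonglongrightarrow> L (K' j)"
        using bounded_linear.tendsto lim(2) [of j] that unfolding o_def by fastforce
    qed
    ultimately show "(S j \<circ> r) \<longlonglongrightarrow> L (K' j)"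
      by (simp add: o_def)
  qed
  have K_le_W: "quad (K' j) v \<le> quad (W (Suc j)) (v + B *v u)" if "j < k" for j u v
  proof (rule LIMSEQ_le)
    show "(\<lambda>t. quad ((K j \<circ> r) t) v) \<longlonglongrightarrow> quad (K' j) v"
      using that by (intro tendsto_quad lim) simp
    have "(\<lambda>t. quad R u / p (r t) + quad ((S (Suc j) \<circ> r) t) (v + B *v u))
        \<longlonglongrightarrow> 0 + quad (W (Suc j)) (v + B *v u)"
      using that by (intro tendsto_add p_lim tendsto_quad lim) simp
    then show "(\<lambda>t. quad R u / p (r t) + quad ((S (Suc j) \<circ> r) t) (v + B *v u))
        \<longlonglongrightarrow> quad (W (Suc j)) (v + B *v u)"
      by simp
  qed (use K_le in auto)
  have "(\<lambda>t. trace ((S 0 \<circ> r) t)) \<longlonglongrightarrow> trace (W 0)"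
    unfolding trace_def by (intro tendsto_sum tendsto_vec_nth lim) simp
  moreover have "trace ((S 0 \<circ> r) t) = 1" for t
    using p_pos [of "r t"] by (simp add: S_def trace_scaleR p_def)
  ultimately have trace_W: "trace (W 0) = 1"
    using LIMSEQ_unique tendsto_const by (metis (no_types, lifting) ext)
  have W_le: "quad (W k) v \<le> quad (W 0) v" for v
  proof (rule LIMSEQ_le)
    show "(\<lambda>t. quad ((S k \<circ> r) t) v) \<longlonglongrightarrow> quad (W k) v"
      "(\<lambda>t. quad ((S 0 \<circ> r) t) v) \<longlonglongrightarrow> quad (W 0) v"
      by (intro tendsto_quad lim; simp)+
    have "quad (S k t) v \<le> quad (S 0 t) v" for t
      using p_pos [of t] by (simp add: S_def quad_scaleR divide_right_mono value_iter_mono)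
    then show "\<exists>N. \<forall>n\<ge>N. quad ((S k \<circ> r) n) v \<le> quad ((S 0 \<circ> r) n) v"
      by simp
  qed
  \<comment> \<open>Limits exist only up to index \<open>k\<close>; beyond it the sequences are continued as constants.\<close>
  show ?thesis
  proof (intro exI conjI allI impI)
    show "pos_semidef (W (min j k))" "pos_semidef (K' (min j k))" for j
      by (simp_all add: psd_W)
    show "W (min j k) = L (K' (min j k))"
      "quad (K' (min j k)) v \<le> quad (W (min (Suc j) k)) (v + B *v u)" if "j < k" for j u v
      using that W_eq K_le_W by simp_all
    show "trace (W (min 0 k)) = 1" "quad (W (min k k)) v \<le> quad (W (min 0 k)) v" for v
      by (simp_all add: trace_W W_le)
  qed
qed

end

section \<open>Measurability of trajectories\<close>

lemma borel_measurable_matrix_vector_mult [measurable (raw)]: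
  fixes f :: "'a \<Rightarrow> real^'n^'m"
  assumes "f \<in> borel_measurable N" "g \<in> borel_measurable N"
  shows "(\<lambda>y. f y *v g y) \<in> borel_measurable N"
  using assms
  by (rule borel_measurable_continuous_Pair)
    (simp add: matrix_vector_mult_def, intro continuous_intros)

lemma borel_measurable_matrix_nth [measurable (raw)]:
  fixes f :: "'a \<Rightarrow> real^'n^'m"
  assumes "f \<in> borel_measurable N"
  shows "(\<lambda>y. f y $ i) \<in> borel_measurable N"
  by (rule borel_measurable_continuous_on [OF _ assms]) (intro continuous_intros)

lemma borel_measurable_quad [measurable (raw)]:
  fixes f :: "'a \<Rightarrow> real^'n"
  assumes [measurable]: "f \<in> borel_measurable N"
  shows "(\<lambda>y. quad X (f y)) \<in> borel_measurable N"
  by measurable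

lemma sum_block:
  fixes f :: "'k::finite \<Rightarrow> 's::finite" and v :: "'a::comm_monoid_add^'k"
  shows "(\<Sum>i\<in>UNIV. block f i v) = v"
  by (simp add: vec_eq_iff block_def)

lemma borel_measurable_block [measurable (raw)]:
  fixes f :: "'a \<Rightarrow> real^'k"
  assumes "f \<in> borel_measurable N"
  shows "(\<lambda>y. block g i (f y)) \<in> borel_measurable N"
proof (rule borel_measurable_continuous_on [OF _ assms])
  show "continuous_on UNIV (block g i :: real^'k \<Rightarrow> real^'k)"
  proof -
    have "continuous_on UNIV (\<lambda>v::real^'k. if g r = i then v $ r else 0)" for r
      by (cases "g r = i") (auto intro!: continuous_intros)
    then show ?thesis
      unfolding block_def by (intro continuous_intros)
  qed
qed

text \<open>Joint measurability of the stacked law at each time; the block partition of the input is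
  irrelevant to it.\<close>

definition measurable_law :: "('n::finite, 'm::finite) law \<Rightarrow> bool" where
  "measurable_law \<psi> \<longleftrightarrow>
    (\<forall>k. (\<lambda>(a, xs). \<psi> k a xs) \<in> borel_measurable (borel \<Otimes>\<^sub>M (\<Pi>\<^sub>M j\<in>{..k}. borel)))"

lemma full_info_laws_iff:
  fixes bu :: "'m::finite \<Rightarrow> 's::finite"
  shows "\<psi> \<in> full_info_laws bu \<longleftrightarrow> measurable_law \<psi>"
proof
  assume \<psi>: "\<psi> \<in> full_info_laws bu"
  show "measurable_law \<psi>"
    unfolding measurable_law_def
  proof
    fix k
    have "(\<lambda>p. \<Sum>i\<in>UNIV. (\<lambda>(a, xs). block bu i (\<psi> k a xs)) p)
        \<in> borel_measurable (borel \<Otimes>\<^sub>M (\<Pi>\<^sub>M j\<in>{..k}. borel))"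
      using \<psi> by (intro borel_measurable_sum) (simp add: full_info_laws_def)
    then show "(\<lambda>(a, xs). \<psi> k a xs) \<in> borel_measurable (borel \<Otimes>\<^sub>M (\<Pi>\<^sub>M j\<in>{..k}. borel))"
      by (simp add: case_prod_beta sum_block)
  qed
next
  assume \<psi>: "measurable_law \<psi>"
  have "(\<lambda>p. block bu i ((\<lambda>(a, xs). \<psi> k a xs) p))
      \<in> borel_measurable (borel \<Otimes>\<^sub>M (\<Pi>\<^sub>M j\<in>{..k}. borel))" for k i
    using \<psi> by (intro borel_measurable_block) (simp add: measurable_law_def)
  then show "\<psi> \<in> full_info_laws bu"
    by (simp add: full_info_laws_def case_prod_beta)
qed

lemma measurable_feedback_law:
  assumes \<Gamma>: "\<Gamma> \<in> borel_measurable borel"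
  shows "measurable_law (feedback_law \<Gamma>)"
  unfolding measurable_law_def
proof
  fix k :: nat
  have "(\<lambda>p. \<Gamma> (fst p) *v (snd p) k) \<in> borel_measurable (borel \<Otimes>\<^sub>M (\<Pi>\<^sub>M j\<in>{..k}. borel))"
  proof (rule borel_measurable_matrix_vector_mult)
    show "(\<lambda>p. \<Gamma> (fst p)) \<in> borel_measurable (borel \<Otimes>\<^sub>M (\<Pi>\<^sub>M j\<in>{..k}. borel))"
      by (rule measurable_compose [OF measurable_fst \<Gamma>])
    show "(\<lambda>p. (snd p) k) \<in> borel_measurable (borel \<Otimes>\<^sub>M (\<Pi>\<^sub>M j\<in>{..k}. borel))"
      by (rule measurable_compose [OF measurable_snd measurable_component_singleton]) simp
  qed
  then show "(\<lambda>(a, xs). feedback_law \<Gamma> k a xs)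
      \<in> borel_measurable (borel \<Otimes>\<^sub>M (\<Pi>\<^sub>M j\<in>{..k}. borel))"
    by (simp add: case_prod_beta feedback_law_def)
qed

lemma measurable_law_lqr:
  fixes B :: "real^'m^'n"
  shows "measurable_law (feedback_law (lqr_gain B R P))"
proof (rule measurable_feedback_law, rule borel_measurable_continuous_onI)
  have "continuous_on UNIV (\<lambda>a. - (C ** a))" for C :: "real^'n^'m"
    unfolding matrix_matrix_mult_def by (intro continuous_intros)
  then show "continuous_on UNIV (lqr_gain B R P)"
    unfolding lqr_gain_def .
qed

text \<open>The state at time \<open>k\<close> depends only on the matrices before time \<open>k\<close>.\<close>

lemma state_cong:
  "(\<And>j. j < k \<Longrightarrow> a j = a' j) \<Longrightarrow> state B \<psi> a x0 k = state B \<psi> a' x0 k"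
proof (induction k rule: less_induct)
  case (less k)
  show ?case
  proof (cases k)
    case (Suc l)
    have "state B \<psi> a x0 j = state B \<psi> a' x0 j" if "j \<le> l" for j
      using that less by (simp add: Suc)
    then show ?thesis
      using less.prems [of l] by (simp add: Suc cong: restrict_cong)
  qed simp
qed

lemma borel_measurable_state:
  fixes a :: "nat \<Rightarrow> 'a \<Rightarrow> real^'n^'n"
  assumes \<psi>: "measurable_law \<psi>"
  shows "(\<And>j. j < k \<Longrightarrow> a j \<in> borel_measurable N) \<Longrightarrow>
    (\<lambda>y. state B \<psi> (\<lambda>j. a j y) x0 k) \<in> borel_measurable N"
proof (induction k rule: less_induct)
  case (less k)
  show ?case
  proof (cases k)
    case (Suc l)
    have states: "(\<lambda>y. state B \<psi> (\<lambda>j. a j y) x0 j) \<in> borel_measurable N" if "j \<le> l" for j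
      using that less by (simp add: Suc)
    have [measurable]: "a l \<in> borel_measurable N"
      by (rule less.prems) (simp add: Suc)
    have [measurable]: "(\<lambda>y. state B \<psi> (\<lambda>j. a j y) x0 l) \<in> borel_measurable N"
      by (rule states) simp
    have "(\<lambda>y. \<lambda>j\<in>{..l}. state B \<psi> (\<lambda>j. a j y) x0 j) \<in> measurable N (\<Pi>\<^sub>M j\<in>{..l}. borel)"
      by (intro measurable_restrict states) simp
    then have pair: "(\<lambda>y. (a l y, \<lambda>j\<in>{..l}. state B \<psi> (\<lambda>j. a j y) x0 j))
        \<in> measurable N (borel \<Otimes>\<^sub>M (\<Pi>\<^sub>M j\<in>{..l}. borel))"
      by (intro measurable_Pair) simp_all
    have [measurable]:
      "(\<lambda>y. \<psi> l (a l y) (\<lambda>j\<in>{..l}. state B \<psi> (\<lambda>j. a j y) x0 j)) \<in> borel_measurable N"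
      using measurable_compose [OF pair spec [OF \<psi> [unfolded measurable_law_def], of l]] by simp
    show ?thesis
      unfolding Suc state.simps by measurable
  qed simp
qed

lemma borel_measurable_control:
  fixes a :: "nat \<Rightarrow> 'a \<Rightarrow> real^'n^'n"
  assumes \<psi>: "measurable_law \<psi>" and a: "\<And>j. a j \<in> borel_measurable N"
  shows "(\<lambda>y. control B \<psi> (\<lambda>j. a j y) x0 k) \<in> borel_measurable N"
proof -
  have "(\<lambda>y. \<lambda>j\<in>{..k}. state B \<psi> (\<lambda>j. a j y) x0 j) \<in> measurable N (\<Pi>\<^sub>M j\<in>{..k}. borel)"
    by (intro measurable_restrict borel_measurable_state \<psi> a)
  then have "(\<lambda>y. (a k y, \<lambda>j\<in>{..k}. state B \<psi> (\<lambda>j. a j y) x0 j))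
      \<in> measurable N (borel \<Otimes>\<^sub>M (\<Pi>\<^sub>M j\<in>{..k}. borel))"
    by (intro measurable_Pair a) simp_all
  from measurable_compose [OF this spec [OF \<psi> [unfolded measurable_law_def], of k]]
  show ?thesis
    by (simp add: control_def)
qed

section \<open>Second moments and independence\<close>

lemma has_bochner_integral_vec_nth:
  fixes f :: "'w \<Rightarrow> 'a::euclidean_space^'n"
  assumes "has_bochner_integral M f x"
  shows "has_bochner_integral M (\<lambda>\<omega>. f \<omega> $ i) (x $ i)"
  by (rule has_bochner_integral_bounded_linear [OF bounded_linear_vec_nth assms])

lemma has_bochner_integral_matrix:
  fixes f :: "'w \<Rightarrow> real^'n^'m"
  assumes "\<And>i j. has_bochner_integral M (\<lambda>\<omega>. f \<omega> $ i $ j) (x $ i $ j)"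
  shows "has_bochner_integral M f x"
proof -
  have expand: "y = (\<Sum>i\<in>UNIV. \<Sum>j\<in>UNIV. y $ i $ j *\<^sub>R axis i (axis j (1::real)))" for y :: "real^'n^'m"
  proof -
    have "(\<Sum>i\<in>UNIV. \<Sum>j\<in>UNIV. y $ i $ j *\<^sub>R axis i (axis j (1::real))) $ r $ s =
        (\<Sum>i\<in>UNIV. \<Sum>j\<in>UNIV. if i = r then if j = s then y $ i $ j else 0 else 0)" for r s
      unfolding sum_component vector_scaleR_component
      by (intro sum.cong refl) (auto simp: axis_def)
    also have "\<dots> r s = y $ r $ s" for r s
      by (simp add: sum.If_cases sum.delta if_distrib [of "sum _"] cong: if_cong)
    finally show ?thesis
      by (simp add: vec_eq_iff)
  qed
  have "has_bochner_integral M
      (\<lambda>\<omega>. \<Sum>i\<in>UNIV. \<Sum>j\<in>UNIV. f \<omega> $ i $ j *\<^sub>R axis i (axis j (1::real)))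
      (\<Sum>i\<in>UNIV. \<Sum>j\<in>UNIV. x $ i $ j *\<^sub>R axis i (axis j (1::real)))"
    by (intro has_bochner_integral_sum has_bochner_integral_scaleR_left assms)
  then show ?thesis
    by (simp only: expand [symmetric])
qed

lemma congruence_entry:
  fixes A K :: "real^'n^'n"
  shows "(transpose A ** K ** A) $ i $ j = (\<Sum>r\<in>UNIV. \<Sum>s\<in>UNIV. K $ r $ s * (A $ r $ i * A $ s $ j))"
proof -
  have "(transpose A ** K ** A) $ i $ j = (\<Sum>s\<in>UNIV. \<Sum>r\<in>UNIV. K $ r $ s * (A $ r $ i * A $ s $ j))"
    by (simp add: matrix_matrix_mult_def transpose_def sum_distrib_left sum_distrib_right mult_ac)
  then show ?thesis
    using sum.swap by (rule trans)
qed

text \<open>The expectation of \<open>transpose A ** K ** A\<close> is determined by the second moments \<open>S\<close> of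
  \<open>A\<close>, that is, by the expectation of \<open>kronecker A A\<close>.\<close>

definition moment_map :: "real^('n \<times> 'n)^('n \<times> 'n) \<Rightarrow> real^'n^'n \<Rightarrow> real^'n^'n" where
  "moment_map S K = (\<chi> i j. \<Sum>r\<in>UNIV. \<Sum>s\<in>UNIV. K $ r $ s * S $ (r, s) $ (i, j))"

lemma linear_moment_map: "linear (moment_map S)"
proof (rule linearI)
  show "moment_map S (X + Y) = moment_map S X + moment_map S Y" for X Y
    by (simp add: moment_map_def vec_eq_iff distrib_right sum.distrib)
  show "moment_map S (c *\<^sub>R X) = c *\<^sub>R moment_map S X" for c X
    by (simp add: moment_map_def vec_eq_iff sum_distrib_left mult_ac)
qed

text \<open>Random system matrices with time-invariant first and second moments, whose block rows are
  independent.  The matrices need not be identically distributed.\<close>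

locale random_plant = prob_space M for M :: "'w measure" +
  fixes bx :: "'n::finite \<Rightarrow> 's::finite" and A :: "nat \<Rightarrow> 'w \<Rightarrow> real^'n^'n"
    and Abar :: "real^'n^'n" and \<Sigma> :: "real^('n \<times> 'n)^('n \<times> 'n)"
  assumes integrable_A: "\<And>k. integrable M (A k)"
    and integrable_AA: "\<And>k. integrable M (\<lambda>\<omega>. kronecker (A k \<omega>) (A k \<omega>))"
    and indep_rows: "indep_vars (\<lambda>_. borel) (\<lambda>(k, i) \<omega>. block bx i (A k \<omega>)) UNIV"
    and mean_A: "\<And>k. integral\<^sup>L M (A k) = Abar"
    and mean_AA: "\<And>k. (\<integral>\<omega>. kronecker (A k \<omega>) (A k \<omega>) \<partial>M) = \<Sigma>"
begin

lemma measurable_A [measurable]: "A k \<in> borel_measurable M"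
  using integrable_A by (rule borel_measurable_integrable)

lemma first_moment: "has_bochner_integral M (\<lambda>\<omega>. A k \<omega> $ r $ i) (Abar $ r $ i)"
proof -
  have "has_bochner_integral M (A k) Abar"
    by (simp add: has_bochner_integral_iff integrable_A mean_A)
  then show ?thesis
    by (intro has_bochner_integral_vec_nth)
qed

lemma second_moment:
  "has_bochner_integral M (\<lambda>\<omega>. A k \<omega> $ r $ i * A k \<omega> $ s $ j) (\<Sigma> $ (r, s) $ (i, j))"
proof -
  have "has_bochner_integral M (\<lambda>\<omega>. kronecker (A k \<omega>) (A k \<omega>)) \<Sigma>"
    by (simp add: has_bochner_integral_iff integrable_AA mean_AA)
  then have "has_bochner_integral M (\<lambda>\<omega>. kronecker (A k \<omega>) (A k \<omega>) $ (r, s) $ (i, j))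
      (\<Sigma> $ (r, s) $ (i, j))"
    by (intro has_bochner_integral_vec_nth)
  then show ?thesis
    by (simp add: kronecker_def)
qed

lemma expectation_congruence:
  "has_bochner_integral M (\<lambda>\<omega>. transpose (A k \<omega>) ** K ** A k \<omega>) (moment_map \<Sigma> K)"
proof (rule has_bochner_integral_matrix)
  show "has_bochner_integral M (\<lambda>\<omega>. (transpose (A k \<omega>) ** K ** A k \<omega>) $ i $ j)
      (moment_map \<Sigma> K $ i $ j)" for i j
    unfolding congruence_entry moment_map_def vec_lambda_beta
    by (intro has_bochner_integral_sum has_bochner_integral_mult_right second_moment)
qed

lemma expectation_quad:
  "has_bochner_integral M (\<lambda>\<omega>. quad K (A k \<omega> *v v)) (quad (moment_map \<Sigma> K) v)"
proof -
  have "has_bochner_integral M (\<lambda>\<omega>. quad (transpose (A k \<omega>) ** K ** A k \<omega>) v)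
      (quad (moment_map \<Sigma> K) v)"
    unfolding quad_eq_sum
    by (intro has_bochner_integral_sum has_bochner_integral_mult_left
        has_bochner_integral_vec_nth expectation_congruence)
  then show ?thesis
    by (simp only: quad_congruence)
qed

lemma pos_semidef_moment_map:
  assumes K: "pos_semidef K"
  shows "pos_semidef (moment_map \<Sigma> K)"
proof -
  have sym: "K $ r $ s = K $ s $ r" for r s
    using pos_semidef_sym [OF K] by (simp add: transpose_def vec_eq_iff)
  have swap: "\<Sigma> $ (r, s) $ (i, j) = \<Sigma> $ (s, r) $ (j, i)" for r s i j
    using second_moment [of 0 r i s j] second_moment [of 0 s j r i]
    by (simp add: mult.commute has_bochner_integral_eq)
  have "moment_map \<Sigma> K $ i $ j = moment_map \<Sigma> K $ j $ i" for i j
  proof -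
    have "(\<Sum>r\<in>UNIV. \<Sum>s\<in>UNIV. K $ r $ s * \<Sigma> $ (r, s) $ (i, j)) =
        (\<Sum>r\<in>UNIV. \<Sum>s\<in>UNIV. K $ s $ r * \<Sigma> $ (s, r) $ (j, i))"
      by (simp only: sym [symmetric] swap [symmetric])
    then show ?thesis
      unfolding moment_map_def vec_lambda_beta using sum.swap by (rule trans)
  qed
  then have "transpose (moment_map \<Sigma> K) = moment_map \<Sigma> K"
    by (simp add: transpose_def vec_eq_iff)
  moreover have "0 \<le> quad (moment_map \<Sigma> K) v" for v
    unfolding has_bochner_integral_integral_eq [OF expectation_quad [where k = 0], symmetric]
    by (rule Bochner_Integration.integral_nonneg) (rule pos_semidef_ge_0 [OF K])
  ultimately show ?thesis
    by (simp add: pos_semidef_def)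
qed

text \<open>Disjoint groups of block rows are independent.\<close>

lemma indep_row_groups:
  assumes "I \<inter> J = {}"
  shows "indep_var (\<Pi>\<^sub>M p\<in>I. borel) (\<lambda>\<omega>. \<lambda>p\<in>I. block bx (snd p) (A (fst p) \<omega>))
    (\<Pi>\<^sub>M p\<in>J. borel) (\<lambda>\<omega>. \<lambda>p\<in>J. block bx (snd p) (A (fst p) \<omega>))"
  using indep_var_restrict [OF indep_rows assms] by (simp add: case_prod_beta)

lemma rows_uncorrelated:
  assumes "bx r \<noteq> bx s"
  shows "\<Sigma> $ (r, s) $ (i, j) = Abar $ r $ i * Abar $ s $ j"
proof -
  define p q where "p = (0::nat, bx r)" and "q = (0::nat, bx s)"
  have ind: "indep_var (\<Pi>\<^sub>M p\<in>{p}. borel) (\<lambda>\<omega>. \<lambda>p\<in>{p}. block bx (snd p) (A (fst p) \<omega>))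
      (\<Pi>\<^sub>M p\<in>{q}. borel) (\<lambda>\<omega>. \<lambda>p\<in>{q}. block bx (snd p) (A (fst p) \<omega>))"
    by (rule indep_row_groups) (simp add: p_def q_def assms)
  have entry: "(\<lambda>y :: nat \<times> 's \<Rightarrow> real^'n^'n. y x $ l $ t) \<in> borel_measurable (\<Pi>\<^sub>M p\<in>{x}. borel)"
    for x :: "nat \<times> 's" and l t :: 'n
  proof -
    have "(\<lambda>y. y x) \<in> measurable (\<Pi>\<^sub>M p\<in>{x}. borel) (borel :: (real^'n^'n) measure)"
      by (rule measurable_component_singleton) simp
    from measurable_compose [OF borel_measurable_matrix_nth [OF this] borel_measurable_nth]
    show ?thesis .
  qed
  have "indep_var borel
      ((\<lambda>y. y p $ r $ i) \<circ> (\<lambda>\<omega>. \<lambda>p\<in>{p}. block bx (snd p) (A (fst p) \<omega>)))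
      borel ((\<lambda>y. y q $ s $ j) \<circ> (\<lambda>\<omega>. \<lambda>p\<in>{q}. block bx (snd p) (A (fst p) \<omega>)))"
    by (rule indep_var_compose [OF ind entry entry])
  then have "indep_var borel (\<lambda>\<omega>. A 0 \<omega> $ r $ i) borel (\<lambda>\<omega>. A 0 \<omega> $ s $ j)"
    by (simp add: o_def p_def q_def block_def)
  then have "(\<integral>\<omega>. A 0 \<omega> $ r $ i * A 0 \<omega> $ s $ j \<partial>M) =
      (\<integral>\<omega>. A 0 \<omega> $ r $ i \<partial>M) * (\<integral>\<omega>. A 0 \<omega> $ s $ j \<partial>M)"
    by (rule indep_var_lebesgue_integral) (use first_moment has_bochner_integral_iff in blast)+
  then show ?thesis
    by (simp add: has_bochner_integral_integral_eq [OF first_moment]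
        has_bochner_integral_integral_eq [OF second_moment])
qed

text \<open>Splitting \<open>A k\<close> into its mean and its centred block rows, all mixed terms of the second
  moment vanish.\<close>

lemma moment_map_decomposition:
  "transpose Abar ** K ** Abar +
    (\<Sum>i\<in>UNIV. \<integral>\<omega>. transpose (block bx i (A k \<omega> - Abar)) ** K ** block bx i (A k \<omega> - Abar) \<partial>M)
    = moment_map \<Sigma> K"
proof -
  \<comment> \<open>\<open>C\<close> is the covariance of two entries, and \<open>D i\<close> the contribution of block row \<open>i\<close>.\<close>
  define C where "C r s c d = \<Sigma> $ (r, s) $ (c, d) - Abar $ r $ c * Abar $ s $ d" for r s c d
  have centred: "has_bochner_integral M
      (\<lambda>\<omega>. (A k \<omega> $ r $ c - Abar $ r $ c) * (A k \<omega> $ s $ d - Abar $ s $ d)) (C r s c d)" for r s c d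
  proof -
    have "has_bochner_integral M (\<lambda>\<omega>. A k \<omega> $ r $ c * A k \<omega> $ s $ d
          - A k \<omega> $ r $ c * Abar $ s $ d - Abar $ r $ c * A k \<omega> $ s $ d + Abar $ r $ c * Abar $ s $ d)
        (\<Sigma> $ (r, s) $ (c, d) - Abar $ r $ c * Abar $ s $ d - Abar $ r $ c * Abar $ s $ d
          + Abar $ r $ c * Abar $ s $ d)"
      by (intro has_bochner_integral_add has_bochner_integral_diff has_bochner_integral_mult_left
          has_bochner_integral_mult_right first_moment second_moment)
        (simp add: has_bochner_integral_iff prob_space)
    then show ?thesis
      by (simp add: C_def algebra_simps)
  qed
  define D where
    "D i = (\<chi> c d. \<Sum>r\<in>UNIV. \<Sum>s\<in>UNIV. K $ r $ s * (if bx r = i \<and> bx s = i then C r s c d else 0))" for i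
  have "has_bochner_integral M
      (\<lambda>\<omega>. transpose (block bx i (A k \<omega> - Abar)) ** K ** block bx i (A k \<omega> - Abar)) (D i)" for i
  proof (rule has_bochner_integral_matrix)
    fix c d
    have "has_bochner_integral M
        (\<lambda>\<omega>. block bx i (A k \<omega> - Abar) $ r $ c * block bx i (A k \<omega> - Abar) $ s $ d)
        (if bx r = i \<and> bx s = i then C r s c d else 0)" for r s
      using centred [of r c s d] by (auto simp: block_def)
    then show "has_bochner_integral M
        (\<lambda>\<omega>. (transpose (block bx i (A k \<omega> - Abar)) ** K ** block bx i (A k \<omega> - Abar)) $ c $ d)
        (D i $ c $ d)"
      unfolding congruence_entry D_def vec_lambda_beta
      by (intro has_bochner_integral_sum has_bochner_integral_mult_right)
  qed
  then have "(\<Sum>i\<in>UNIV. \<integral>\<omega>. transpose (block bx i (A k \<omega> - Abar)) ** K **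
      block bx i (A k \<omega> - Abar) \<partial>M) = (\<Sum>i\<in>UNIV. D i)"
    by (intro sum.cong refl has_bochner_integral_integral_eq)
  moreover have "(\<Sum>i\<in>UNIV. D i) $ c $ d = (\<Sum>r\<in>UNIV. \<Sum>s\<in>UNIV. K $ r $ s * C r s c d)" for c d
  proof -
    have "(\<Sum>i\<in>UNIV. K $ r $ s * (if bx r = i \<and> bx s = i then C r s c d else 0)) = K $ r $ s * C r s c d"
      for r s
    proof (cases "bx r = bx s")
      case True
      then show ?thesis
        by (simp add: if_distrib [of "\<lambda>x. K $ r $ s * x"] cong: if_cong)
    next
      case False
      then have "C r s c d = 0"
        by (simp add: C_def rows_uncorrelated)
      then show ?thesis by (simp cong: if_cong)
    qed
    moreover have "(\<Sum>i\<in>UNIV. D i) $ c $ d =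
      (\<Sum>r\<in>UNIV. \<Sum>s\<in>UNIV. \<Sum>i\<in>UNIV. K $ r $ s * (if bx r = i \<and> bx s = i then C r s c d else 0))"
      unfolding sum_component D_def vec_lambda_beta
      by (subst sum.swap, intro sum.cong refl, rule sum.swap)
    ultimately show ?thesis by simp
  qed
  moreover have "(transpose Abar ** K ** Abar) $ c $ d + (\<Sum>r\<in>UNIV. \<Sum>s\<in>UNIV. K $ r $ s * C r s c d)
      = moment_map \<Sigma> K $ c $ d" for c d
    unfolding congruence_entry moment_map_def vec_lambda_beta C_def
    by (simp add: sum.distrib [symmetric] distrib_left [symmetric])
  ultimately show ?thesis
    by (simp add: vec_eq_iff)
qed

lemma mdare_iff:
  "mdare M bx A B Q R k P \<longleftrightarrow> P = Q + moment_map \<Sigma> (stage_min P B R)"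
  unfolding mdare_def riccati_eq mean_A moment_map_decomposition [of _ k, symmetric]
  by (simp add: add.assoc)

text \<open>The state at time \<open>k\<close> is independent of \<open>A k\<close>, so \<open>A k\<close> can be averaged out first.
  The identity holds in the extended nonnegative reals, without any integrability of the state.\<close>

lemma expected_next_stage:
  fixes B :: "nat \<Rightarrow> real^'m^'n" and \<psi> :: "('n, 'm) law" and x0 :: "real^'n" and k :: nat
  assumes \<psi>: "measurable_law \<psi>" and K: "pos_semidef K"
  defines "x \<equiv> \<lambda>\<omega>. state B \<psi> (\<lambda>j. A j \<omega>) x0 k"
  shows "(\<integral>\<^sup>+ \<omega>. ennreal (quad K (A k \<omega> *v x \<omega>)) \<partial>M) =
    (\<integral>\<^sup>+ \<omega>. ennreal (quad (moment_map \<Sigma> K) (x \<omega>)) \<partial>M)"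
proof -
  define I J :: "(nat \<times> 's) set" where "I = {..<k} \<times> UNIV" and "J = {k} \<times> UNIV"
  define X Y where "X = (\<lambda>\<omega>. \<lambda>p\<in>I. block bx (snd p) (A (fst p) \<omega>))"
    and "Y = (\<lambda>\<omega>. \<lambda>p\<in>J. block bx (snd p) (A (fst p) \<omega>))"
  \<comment> \<open>The state and the current matrix as functions of the past and the current block rows.\<close>
  define f where "f = (\<lambda>y :: nat \<times> 's \<Rightarrow> real^'n^'n. state B \<psi> (\<lambda>j. \<Sum>i\<in>UNIV. y (j, i)) x0 k)"
  define g :: "(nat \<times> 's \<Rightarrow> real^'n^'n) \<Rightarrow> real^'n^'n" where "g = (\<lambda>y. \<Sum>i\<in>UNIV. y (k, i))"
  define S T where "S = (\<Pi>\<^sub>M p\<in>I. (borel :: (real^'n^'n) measure))"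
    and "T = (\<Pi>\<^sub>M p\<in>J. (borel :: (real^'n^'n) measure))"
  have "indep_var S X T Y"
    unfolding S_def T_def X_def Y_def by (rule indep_row_groups) (auto simp: I_def J_def)
  then have XY [measurable]: "X \<in> measurable M S" "Y \<in> measurable M T"
    and joint: "distr M S X \<Otimes>\<^sub>M distr M T Y = distr M (S \<Otimes>\<^sub>M T) (\<lambda>\<omega>. (X \<omega>, Y \<omega>))"
    by (simp_all add: indep_var_distribution_eq)
  have f [measurable]: "f \<in> borel_measurable S"
    unfolding f_def S_def
    by (intro borel_measurable_state \<psi> borel_measurable_sum measurable_component_singleton)
      (simp add: I_def)
  have g [measurable]: "g \<in> borel_measurable T"
    unfolding g_def T_def
    by (intro borel_measurable_sum measurable_component_singleton) (simp add: J_def)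
  have fX: "f (X \<omega>) = x \<omega>" for \<omega>
    unfolding f_def x_def X_def by (rule state_cong) (simp add: I_def sum_block)
  have gY: "g (Y \<omega>) = A k \<omega>" for \<omega>
    by (simp add: g_def Y_def J_def sum_block)
  interpret D: prob_space "distr M T Y"
    by (rule prob_space_distr) simp
  define h where "h = (\<lambda>p. ennreal (quad K (g (snd p) *v f (fst p))))"
  have h [measurable]: "h \<in> borel_measurable (S \<Otimes>\<^sub>M T)"
    unfolding h_def by measurable
  have "(\<integral>\<^sup>+ \<omega>. ennreal (quad K (A k \<omega> *v x \<omega>)) \<partial>M) =
      (\<integral>\<^sup>+ p. h p \<partial>distr M (S \<Otimes>\<^sub>M T) (\<lambda>\<omega>. (X \<omega>, Y \<omega>)))"
    by (subst nn_integral_distr) (simp_all add: h_def fX gY)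
  also have "\<dots> = (\<integral>\<^sup>+ p. h p \<partial>(distr M S X \<Otimes>\<^sub>M distr M T Y))"
    by (simp only: joint)
  also have "\<dots> = (\<integral>\<^sup>+ y. \<integral>\<^sup>+ z. h (y, z) \<partial>distr M T Y \<partial>distr M S X)"
    by (rule D.nn_integral_fst [symmetric]) (simp cong: measurable_cong_sets)
  also have "\<dots> = (\<integral>\<^sup>+ y. ennreal (quad (moment_map \<Sigma> K) (f y)) \<partial>distr M S X)"
  proof (rule nn_integral_cong)
    fix y assume "y \<in> space (distr M S X)"
    then have "y \<in> space S" by simp
    then have "(\<lambda>z. h (y, z)) \<in> borel_measurable T"
      by measurable
    then have "(\<integral>\<^sup>+ z. h (y, z) \<partial>distr M T Y) = (\<integral>\<^sup>+ \<omega>. ennreal (quad K (A k \<omega> *v f y)) \<partial>M)"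
      by (subst nn_integral_distr) (simp_all add: h_def gY)
    also have "\<dots> = ennreal (\<integral>\<omega>. quad K (A k \<omega> *v f y) \<partial>M)"
      using expectation_quad [where k = k and K = K and v = "f y"]
      by (intro nn_integral_eq_integral) (auto simp: has_bochner_integral_iff pos_semidef_ge_0 [OF K])
    also have "\<dots> = ennreal (quad (moment_map \<Sigma> K) (f y))"
      by (simp add: has_bochner_integral_integral_eq [OF expectation_quad])
    finally show "(\<integral>\<^sup>+ z. h (y, z) \<partial>distr M T Y) = ennreal (quad (moment_map \<Sigma> K) (f y))" .
  qed
  also have "\<dots> = (\<integral>\<^sup>+ \<omega>. ennreal (quad (moment_map \<Sigma> K) (x \<omega>)) \<partial>M)"
    by (subst nn_integral_distr) (simp_all add: fX)
  finally show ?thesis .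
qed

end

section \<open>Optimal cost over a finite horizon\<close>

lemma state_Suc_control:
  "state B \<psi> a x0 (Suc k) = a k *v state B \<psi> a x0 k + B k *v control B \<psi> a x0 k"
  by (simp add: control_def)

lemma control_feedback_law: "control B (feedback_law \<Gamma>) a x0 k = \<Gamma> (a k) *v state B (feedback_law \<Gamma>) a x0 k"
  by (simp add: control_def feedback_law_def)

text \<open>The cost of stage \<open>k\<close> along a realisation \<open>a\<close> of the system matrices.\<close>

definition stage_cost :: "(nat \<Rightarrow> real^'m^'n) \<Rightarrow> real^'n^'n \<Rightarrow> real^'m^'m \<Rightarrow> ('n, 'm) law
    \<Rightarrow> (nat \<Rightarrow> real^'n^'n) \<Rightarrow> real^'n \<Rightarrow> nat \<Rightarrow> real" where
  "stage_cost B Q R \<psi> a x0 k = quad Q (state B \<psi> a x0 k) + quad R (control B \<psi> a x0 k)"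

lemma stage_cost_nonneg: "pos_semidef Q \<Longrightarrow> pos_semidef R \<Longrightarrow> 0 \<le> stage_cost B Q R \<psi> a x0 k"
  by (simp add: stage_cost_def pos_semidef_ge_0)

context random_plant
begin

lemma measurable_state [measurable]:
  "measurable_law \<psi> \<Longrightarrow> (\<lambda>\<omega>. state B \<psi> (\<lambda>j. A j \<omega>) x0 k) \<in> borel_measurable M"
  by (rule borel_measurable_state) simp_all

lemma measurable_stage_cost [measurable]:
  assumes "measurable_law \<psi>"
  shows "(\<lambda>\<omega>. stage_cost B Q R \<psi> (\<lambda>j. A j \<omega>) x0 k) \<in> borel_measurable M"
  unfolding stage_cost_def
  by (intro borel_measurable_add borel_measurable_quad borel_measurable_control measurable_state
      assms measurable_A)

text \<open>One step of the dynamic programming recursion, in the presence of the cost \<open>c\<close> accumulated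
  so far.\<close>

lemma expected_transition:
  assumes \<psi>: "measurable_law \<psi>" and K: "pos_semidef K" and Q: "pos_semidef Q"
    and c [measurable]: "c \<in> borel_measurable M" and c_nonneg: "\<And>\<omega>. 0 \<le> c \<omega>"
  shows "(\<integral>\<^sup>+ \<omega>. ennreal (c \<omega> + quad (Q + moment_map \<Sigma> K) (state B \<psi> (\<lambda>j. A j \<omega>) x0 k)) \<partial>M) =
    (\<integral>\<^sup>+ \<omega>. ennreal (c \<omega> + (quad Q (state B \<psi> (\<lambda>j. A j \<omega>) x0 k)
      + quad K (A k \<omega> *v state B \<psi> (\<lambda>j. A j \<omega>) x0 k))) \<partial>M)"
proof -
  define x where "x = (\<lambda>\<omega>. state B \<psi> (\<lambda>j. A j \<omega>) x0 k)"
  have [measurable]: "x \<in> borel_measurable M"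
    unfolding x_def by (rule measurable_state [OF \<psi>])
  have split: "(\<integral>\<^sup>+ \<omega>. ennreal (c \<omega> + (quad Q (x \<omega>) + f \<omega>)) \<partial>M) =
      (\<integral>\<^sup>+ \<omega>. ennreal (c \<omega> + quad Q (x \<omega>)) \<partial>M) + (\<integral>\<^sup>+ \<omega>. ennreal (f \<omega>) \<partial>M)"
    if [measurable]: "f \<in> borel_measurable M" and f: "\<And>\<omega>. 0 \<le> f \<omega>" for f
  proof -
    have "(\<integral>\<^sup>+ \<omega>. ennreal (c \<omega> + (quad Q (x \<omega>) + f \<omega>)) \<partial>M) =
        (\<integral>\<^sup>+ \<omega>. ennreal (c \<omega> + quad Q (x \<omega>)) + ennreal (f \<omega>) \<partial>M)"
      by (intro nn_integral_cong)
        (simp add: ennreal_plus [symmetric] c_nonneg f pos_semidef_ge_0 [OF Q] add.assoc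
          del: ennreal_plus)
    also have "\<dots> = (\<integral>\<^sup>+ \<omega>. ennreal (c \<omega> + quad Q (x \<omega>)) \<partial>M) + (\<integral>\<^sup>+ \<omega>. ennreal (f \<omega>) \<partial>M)"
      by (intro nn_integral_add) measurable
    finally show ?thesis .
  qed
  have "(\<integral>\<^sup>+ \<omega>. ennreal (c \<omega> + quad (Q + moment_map \<Sigma> K) (x \<omega>)) \<partial>M) =
      (\<integral>\<^sup>+ \<omega>. ennreal (c \<omega> + quad Q (x \<omega>)) \<partial>M)
        + (\<integral>\<^sup>+ \<omega>. ennreal (quad (moment_map \<Sigma> K) (x \<omega>)) \<partial>M)"
    unfolding quad_add
    by (intro split pos_semidef_ge_0 pos_semidef_moment_map K) measurable
  also have "(\<integral>\<^sup>+ \<omega>. ennreal (quad (moment_map \<Sigma> K) (x \<omega>)) \<partial>M) =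
      (\<integral>\<^sup>+ \<omega>. ennreal (quad K (A k \<omega> *v x \<omega>)) \<partial>M)"
    unfolding x_def by (rule expected_next_stage [OF \<psi> K, symmetric])
  also have "(\<integral>\<^sup>+ \<omega>. ennreal (c \<omega> + quad Q (x \<omega>)) \<partial>M)
        + (\<integral>\<^sup>+ \<omega>. ennreal (quad K (A k \<omega> *v x \<omega>)) \<partial>M) =
      (\<integral>\<^sup>+ \<omega>. ennreal (c \<omega> + (quad Q (x \<omega>) + quad K (A k \<omega> *v x \<omega>))) \<partial>M)"
    by (intro split [symmetric] pos_semidef_ge_0 K) measurable
  finally show ?thesis
    by (simp only: x_def)
qed

text \<open>Dynamic programming inequality.  It is used both for the cost of the problem and, with
  vanishing stage weights, for the second moment of a stabilised state.\<close>

lemma cost_lower_bound: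
  fixes W K :: "nat \<Rightarrow> real^'n^'n" and B :: "real^'m^'n"
  assumes \<psi>: "measurable_law \<psi>" and Q: "pos_semidef Q" and R: "pos_semidef R"
    and W: "\<And>j. pos_semidef (W j)" and K: "\<And>j. pos_semidef (K j)"
    and W_eq: "\<And>j. j < T \<Longrightarrow> W j = Q + moment_map \<Sigma> (K j)"
    and K_le: "\<And>j u v. j < T \<Longrightarrow> quad (K j) v \<le> quad R u + quad (W (Suc j)) (v + B *v u)"
    and "t \<le> T"
  shows "ennreal (quad (W 0) x0) \<le> (\<integral>\<^sup>+ \<omega>. ennreal
    ((\<Sum>k<t. stage_cost (\<lambda>_. B) Q R \<psi> (\<lambda>j. A j \<omega>) x0 k)
      + quad (W t) (state (\<lambda>_. B) \<psi> (\<lambda>j. A j \<omega>) x0 t)) \<partial>M)"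
  using \<open>t \<le> T\<close>
proof (induction t)
  case 0
  show ?case
    by (simp add: emeasure_space_1)
next
  case (Suc t)
  define c where "c \<omega> = (\<Sum>k<t. stage_cost (\<lambda>_. B) Q R \<psi> (\<lambda>j. A j \<omega>) x0 k)" for \<omega>
  define x where "x \<omega> = state (\<lambda>_. B) \<psi> (\<lambda>j. A j \<omega>) x0 t" for \<omega>
  define u where "u \<omega> = control (\<lambda>_. B) \<psi> (\<lambda>j. A j \<omega>) x0 t" for \<omega>
  have [measurable]: "c \<in> borel_measurable M"
    unfolding c_def by (intro borel_measurable_sum measurable_stage_cost \<psi>)
  have c_nonneg: "0 \<le> c \<omega>" for \<omega>
    unfolding c_def by (intro sum_nonneg stage_cost_nonneg Q R)
  have "ennreal (quad (W 0) x0) \<le> (\<integral>\<^sup>+ \<omega>. ennreal (c \<omega> + quad (W t) (x \<omega>)) \<partial>M)"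
    using Suc by (simp add: c_def x_def)
  also have "\<dots> = (\<integral>\<^sup>+ \<omega>. ennreal (c \<omega> + (quad Q (x \<omega>) + quad (K t) (A t \<omega> *v x \<omega>))) \<partial>M)"
    using Suc.prems W_eq [of t] expected_transition [OF \<psi> K [of t] Q _ c_nonneg]
    by (simp add: x_def)
  also have "\<dots> \<le> (\<integral>\<^sup>+ \<omega>. ennreal (c \<omega> + (quad Q (x \<omega>)
      + (quad R (u \<omega>) + quad (W (Suc t)) (A t \<omega> *v x \<omega> + B *v u \<omega>)))) \<partial>M)"
    using Suc.prems by (intro nn_integral_mono ennreal_leI add_left_mono K_le) simp
  also have "\<dots> = (\<integral>\<^sup>+ \<omega>. ennreal ((\<Sum>k<Suc t. stage_cost (\<lambda>_. B) Q R \<psi> (\<lambda>j. A j \<omega>) x0 k)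
      + quad (W (Suc t)) (state (\<lambda>_. B) \<psi> (\<lambda>j. A j \<omega>) x0 (Suc t))) \<partial>M)"
    by (simp only: state_Suc_control sum.lessThan_Suc stage_cost_def c_def x_def u_def add.assoc)
  finally show ?case .
qed

end

section \<open>The infinite horizon\<close>

text \<open>The linear quadratic problem with constant input matrix \<open>B\<close> and weights \<open>Q\<close> and \<open>R\<close>.\<close>

locale lqr_problem = random_plant M bx A Abar \<Sigma>
  for M :: "'w measure" and bx :: "'n::finite \<Rightarrow> 's::finite" and A :: "nat \<Rightarrow> 'w \<Rightarrow> real^'n^'n"
    and Abar :: "real^'n^'n" and \<Sigma> :: "real^('n \<times> 'n)^('n \<times> 'n)" +
  fixes B :: "real^'m^'n" and Q :: "real^'n^'n" and R :: "real^'m^'m"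
  assumes weight_Q: "pos_def Q" and weight_R: "pos_def R"
begin

sublocale riccati_map "moment_map \<Sigma>" Q B R
  by (rule riccati_map.intro)
    (simp_all only: linear_moment_map pos_semidef_moment_map weight_Q weight_R)

lemma psd_Q: "pos_semidef Q" and psd_R: "pos_semidef R"
  by (simp_all add: pos_def_imp_pos_semidef weight_Q weight_R)

lemma J_inf_eq_SUP:
  "J_inf M A (\<lambda>_. B) Q R x0 \<psi> =
    (SUP T. \<integral>\<^sup>+ \<omega>. ennreal (\<Sum>k<T. stage_cost (\<lambda>_. B) Q R \<psi> (\<lambda>j. A j \<omega>) x0 k) \<partial>M)"
proof -
  have "incseq (\<lambda>T. \<integral>\<^sup>+ \<omega>. ennreal (\<Sum>k<T. stage_cost (\<lambda>_. B) Q R \<psi> (\<lambda>j. A j \<omega>) x0 k) \<partial>M)"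
    by (intro incseq_SucI nn_integral_mono ennreal_leI)
      (simp add: stage_cost_nonneg psd_Q psd_R)
  from limI [OF LIMSEQ_SUP [OF this]] show ?thesis
    by (simp add: J_inf_def stage_cost_def Let_def)
qed

lemma finite_cost_lower_bound:
  assumes "measurable_law \<psi>"
  shows "ennreal (quad (value_iter T) x0) \<le>
    (\<integral>\<^sup>+ \<omega>. ennreal (\<Sum>k<T. stage_cost (\<lambda>_. B) Q R \<psi> (\<lambda>j. A j \<omega>) x0 k) \<partial>M)"
proof -
  have "value_iter (T - j) = Q + moment_map \<Sigma> (stage_min (value_iter (T - Suc j)) B R)"
    if "j < T" for j
  proof -
    have "T - j = Suc (T - Suc j)" using that by simp
    then show ?thesis by (simp add: value_iter_Suc riccati_step_def)
  qed
  from cost_lower_bound [where W = "\<lambda>j. value_iter (T - j)" and t = T and ?x0.0 = x0,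
      OF assms psd_Q psd_R pos_semidef_value_iter
        pos_semidef_stage_min [OF pos_semidef_value_iter weight_R] this
        stage_min_le [OF pos_semidef_value_iter weight_R] order_refl]
  show ?thesis by simp
qed

text \<open>A stabilising feedback keeps the value iterates bounded.  Neither its cost nor the second
  moments at intermediate times need to be finite: the limit problem of
  \<open>unbounded_value_iter\<close> charges only for the final state, and for a single time \<open>k\<close> at which the
  second moments are small enough that charge contradicts its lower bound.\<close>

lemma trace_value_iter_bounded:
  assumes "ms_stabilizable M A (\<lambda>_. B)"
  obtains b where "\<And>t. trace (value_iter t) \<le> b"
proof -
  obtain \<Gamma> where \<Gamma>: "\<Gamma> \<in> borel_measurable borel" and stable: "ms_stable M A (\<lambda>_. B) (feedback_law \<Gamma>)"
    using assms by (auto simp: ms_stabilizable_def)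
  define x where "x i k \<omega> = state (\<lambda>_. B) (feedback_law \<Gamma>) (\<lambda>j. A j \<omega>) (axis i 1) k" for i :: 'n and k \<omega>
  define e where "e i k = (\<integral>\<^sup>+ \<omega>. ennreal (x i k \<omega> \<bullet> x i k \<omega>) \<partial>M)" for i :: 'n and k
  define n where "n = real CARD('n)^2"
  have n: "0 \<le> n" by (simp add: n_def)
  have law: "measurable_law (feedback_law \<Gamma>)"
    by (rule measurable_feedback_law [OF \<Gamma>])
  have meas [measurable]: "x i k \<in> borel_measurable M" for i k
    unfolding x_def by (rule measurable_state [OF law])
  have "(\<lambda>k. ennreal n * (\<Sum>i\<in>UNIV. e i k)) \<longlonglongrightarrow> ennreal n * (\<Sum>i\<in>(UNIV :: 'n set). 0)"
    using stable unfolding ms_stable_def e_def x_def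
    by (intro ennreal_tendsto_cmult tendsto_sum) auto
  then have "eventually (\<lambda>k. ennreal n * (\<Sum>i\<in>UNIV. e i k) < 1) sequentially"
    by (intro order_tendstoD) auto
  then obtain k where k: "ennreal n * (\<Sum>i\<in>UNIV. e i k) < 1"
    by (auto simp: eventually_sequentially)
  have "\<exists>b. \<forall>t. trace (value_iter t) \<le> b"
  proof (rule ccontr)
    assume "\<not> ?thesis"
    then have "\<And>b. \<exists>t. b < trace (value_iter t)"
      by (simp add: not_le)
    from unbounded_value_iter [OF this, of k] obtain W K where
      W: "\<And>j. pos_semidef (W j)" and K: "\<And>j. pos_semidef (K j)"
      and W_eq: "\<And>j. j < k \<Longrightarrow> W j = moment_map \<Sigma> (K j)"
      and K_le: "\<And>j u v. j < k \<Longrightarrow> quad (K j) v \<le> quad (W (Suc j)) (v + B *v u)"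
      and trace: "trace (W 0) = 1" and le: "\<And>v. quad (W k) v \<le> quad (W 0) v"
      by blast
    have "ennreal (W 0 $ i $ i) \<le> ennreal n * e i k" for i
    proof -
      have "ennreal (quad (W 0) (axis i 1)) \<le>
          (\<integral>\<^sup>+ \<omega>. ennreal ((\<Sum>l<k. stage_cost (\<lambda>_. B) 0 0 (feedback_law \<Gamma>) (\<lambda>j. A j \<omega>) (axis i 1) l)
            + quad (W k) (state (\<lambda>_. B) (feedback_law \<Gamma>) (\<lambda>j. A j \<omega>) (axis i 1) k)) \<partial>M)"
        by (rule cost_lower_bound [where K = K and T = k])
          (simp_all add: law W K W_eq K_le pos_semidef_zero)
      also have "\<dots> = (\<integral>\<^sup>+ \<omega>. ennreal (quad (W k) (x i k \<omega>)) \<partial>M)"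
        by (simp add: stage_cost_def x_def)
      also have "\<dots> \<le> (\<integral>\<^sup>+ \<omega>. ennreal n * ennreal (x i k \<omega> \<bullet> x i k \<omega>) \<partial>M)"
      proof (rule nn_integral_mono)
        fix \<omega>
        have "quad (W k) (x i k \<omega>) \<le> n * 1 * (x i k \<omega> \<bullet> x i k \<omega>)"
          unfolding n_def trace [symmetric]
          by (intro order_trans [OF le] quad_le_of_entries pos_semidef_entry_le_trace W)
        then show "ennreal (quad (W k) (x i k \<omega>)) \<le> ennreal n * ennreal (x i k \<omega> \<bullet> x i k \<omega>)"
          by (simp add: ennreal_mult' [symmetric] ennreal_leI n)
      qed
      also have "\<dots> = ennreal n * e i k"
        unfolding e_def by (rule nn_integral_cmult) measurable
      finally show ?thesis by (simp add: quad_axis)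
    qed
    then have "(\<Sum>i\<in>UNIV. ennreal (W 0 $ i $ i)) \<le> (\<Sum>i\<in>UNIV. ennreal n * e i k)"
      by (rule sum_mono)
    moreover have "(\<Sum>i\<in>UNIV. ennreal (W 0 $ i $ i)) = ennreal (trace (W 0))"
      unfolding trace_def using pos_semidef_ge_0 [OF W, of "axis _ 1" 0]
      by (intro sum_ennreal) (simp add: quad_axis)
    ultimately show False
      using k by (simp add: trace sum_distrib_left [symmetric])
  qed
  then show ?thesis
    using that by blast
qed

context
  fixes P :: "real^'n^'n"
  assumes P: "pos_def P" and fixed: "riccati_step P = P"
begin

lemma psd_P: "pos_semidef P"
  by (rule pos_def_imp_pos_semidef [OF P])

lemma optimal_stage:
  "stage_cost (\<lambda>_. B) Q R (feedback_law (lqr_gain B R P)) a x0 k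
      + quad P (state (\<lambda>_. B) (feedback_law (lqr_gain B R P)) a x0 (Suc k)) =
    quad Q (state (\<lambda>_. B) (feedback_law (lqr_gain B R P)) a x0 k)
      + quad (stage_min P B R) (a k *v state (\<lambda>_. B) (feedback_law (lqr_gain B R P)) a x0 k)"
  unfolding stage_cost_def state_Suc_control control_feedback_law
  using stage_min_attained [OF psd_P weight_R lqr_gain_apply]
  by (simp add: lqr_gain_apply [symmetric])

lemma optimal_cost_balance:
  "(\<integral>\<^sup>+ \<omega>. ennreal ((\<Sum>k<t. stage_cost (\<lambda>_. B) Q R (feedback_law (lqr_gain B R P)) (\<lambda>j. A j \<omega>) x0 k)
      + quad P (state (\<lambda>_. B) (feedback_law (lqr_gain B R P)) (\<lambda>j. A j \<omega>) x0 t)) \<partial>M) =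
    ennreal (quad P x0)"
proof (induction t)
  case 0
  show ?case by (simp add: emeasure_space_1)
next
  case (Suc t)
  define \<psi> where "\<psi> = feedback_law (lqr_gain B R P)"
  define c where "c \<omega> = (\<Sum>k<t. stage_cost (\<lambda>_. B) Q R \<psi> (\<lambda>j. A j \<omega>) x0 k)" for \<omega>
  have law: "measurable_law \<psi>"
    unfolding \<psi>_def by (rule measurable_law_lqr)
  have c [measurable]: "c \<in> borel_measurable M"
    unfolding c_def by (intro borel_measurable_sum measurable_stage_cost law)
  have c_nonneg: "0 \<le> c \<omega>" for \<omega>
    unfolding c_def by (intro sum_nonneg stage_cost_nonneg psd_Q psd_R)
  have "(\<integral>\<^sup>+ \<omega>. ennreal ((\<Sum>k<Suc t. stage_cost (\<lambda>_. B) Q R \<psi> (\<lambda>j. A j \<omega>) x0 k)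
        + quad P (state (\<lambda>_. B) \<psi> (\<lambda>j. A j \<omega>) x0 (Suc t))) \<partial>M) =
      (\<integral>\<^sup>+ \<omega>. ennreal (c \<omega> + (quad Q (state (\<lambda>_. B) \<psi> (\<lambda>j. A j \<omega>) x0 t)
        + quad (stage_min P B R) (A t \<omega> *v state (\<lambda>_. B) \<psi> (\<lambda>j. A j \<omega>) x0 t))) \<partial>M)"
    by (simp only: \<psi>_def c_def sum.lessThan_Suc add.assoc optimal_stage)
  also have "\<dots> = (\<integral>\<^sup>+ \<omega>. ennreal (c \<omega> + quad (riccati_step P) (state (\<lambda>_. B) \<psi> (\<lambda>j. A j \<omega>) x0 t)) \<partial>M)"
    unfolding riccati_step_def
    by (rule expected_transition [symmetric, OF law pos_semidef_stage_min [OF psd_P weight_R]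
          psd_Q c c_nonneg])
  finally show ?case
    using Suc by (simp only: fixed \<psi>_def c_def)
qed

lemma J_inf_lqr_le: "J_inf M A (\<lambda>_. B) Q R x0 (feedback_law (lqr_gain B R P)) \<le> ennreal (quad P x0)"
  unfolding J_inf_eq_SUP
proof (rule SUP_least)
  fix T
  show "(\<integral>\<^sup>+ \<omega>. ennreal (\<Sum>k<T. stage_cost (\<lambda>_. B) Q R (feedback_law (lqr_gain B R P))
      (\<lambda>j. A j \<omega>) x0 k) \<partial>M) \<le> ennreal (quad P x0)"
    unfolding optimal_cost_balance [where t = T, symmetric]
    by (intro nn_integral_mono ennreal_leI) (simp add: pos_semidef_ge_0 [OF psd_P])
qed

text \<open>Along the optimal trajectory the expectation of \<open>quad P\<close> contracts, because the part
  \<open>quad Q\<close> of it is paid at each stage.\<close>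

lemma ms_stable_lqr: "ms_stable M A (\<lambda>_. B) (feedback_law (lqr_gain B R P))"
  unfolding ms_stable_def
proof
  fix x0
  define \<psi> where "\<psi> = feedback_law (lqr_gain B R P)"
  define x where "x k \<omega> = state (\<lambda>_. B) \<psi> (\<lambda>j. A j \<omega>) x0 k" for k \<omega>
  have law: "measurable_law \<psi>"
    unfolding \<psi>_def by (rule measurable_law_lqr)
  have [measurable]: "x k \<in> borel_measurable M" for k
    unfolding x_def by (rule measurable_state [OF law])
  obtain d where d: "1 \<le> d" "\<And>v. quad P v \<le> d * quad Q v"
    using pos_def_dominates [OF psd_P weight_Q] by blast
  \<comment> \<open>The contraction factor: \<open>Q\<close> is at least the fraction \<open>1 / d\<close> of \<open>P\<close>.\<close>
  define q where "q = 1 - 1 / d"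
  have q: "0 \<le> q" "q < 1"
    using d(1) by (auto simp: q_def)
  have contract: "quad (moment_map \<Sigma> (stage_min P B R)) v \<le> q * quad P v" for v
  proof -
    have "quad P v = quad Q v + quad (moment_map \<Sigma> (stage_min P B R)) v"
      using fixed by (metis quad_add riccati_step_def)
    moreover have "1 / d * quad P v \<le> quad Q v"
      using d by (simp add: field_simps)
    ultimately show ?thesis
      by (simp add: q_def left_diff_distrib)
  qed
  have decay: "(\<integral>\<^sup>+ \<omega>. ennreal (quad P (x k \<omega>)) \<partial>M) \<le> ennreal (q ^ k * quad P x0)" for k
  proof (induction k)
    case 0
    show ?case by (simp add: x_def emeasure_space_1)
  next
    case (Suc k)
    have "quad P (x (Suc k) \<omega>) \<le> quad (stage_min P B R) (A k \<omega> *v x k \<omega>)" for \<omega>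
      using optimal_stage [of "\<lambda>j. A j \<omega>" x0 k] pos_semidef_ge_0 [OF psd_R]
      unfolding stage_cost_def x_def \<psi>_def by (smt (verit))
    then have "(\<integral>\<^sup>+ \<omega>. ennreal (quad P (x (Suc k) \<omega>)) \<partial>M) \<le>
        (\<integral>\<^sup>+ \<omega>. ennreal (quad (stage_min P B R) (A k \<omega> *v x k \<omega>)) \<partial>M)"
      by (intro nn_integral_mono ennreal_leI)
    also have "\<dots> = (\<integral>\<^sup>+ \<omega>. ennreal (quad (moment_map \<Sigma> (stage_min P B R)) (x k \<omega>)) \<partial>M)"
      unfolding x_def
      by (rule expected_next_stage [OF law pos_semidef_stage_min [OF psd_P weight_R]])
    also have "\<dots> \<le> (\<integral>\<^sup>+ \<omega>. ennreal q * ennreal (quad P (x k \<omega>)) \<partial>M)"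
      using contract q(1)
      by (intro nn_integral_mono) (simp add: ennreal_mult' [symmetric] ennreal_leI)
    also have "\<dots> = ennreal q * (\<integral>\<^sup>+ \<omega>. ennreal (quad P (x k \<omega>)) \<partial>M)"
      by (rule nn_integral_cmult) measurable
    also have "\<dots> \<le> ennreal q * ennreal (q ^ k * quad P x0)"
      by (intro mult_left_mono Suc) simp
    also have "\<dots> = ennreal (q ^ Suc k * quad P x0)"
      using q(1) by (simp add: ennreal_mult' [symmetric] mult.assoc)
    finally show ?case .
  qed
  obtain p where p: "0 < p" "\<And>v. p * (v \<bullet> v) \<le> quad P v"
    using pos_def_lower_bound [OF P] by blast
  have bound: "(\<integral>\<^sup>+ \<omega>. ennreal (x k \<omega> \<bullet> x k \<omega>) \<partial>M) \<le> ennreal (1 / p) * ennreal (q ^ k * quad P x0)" for k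
  proof -
    have "(\<integral>\<^sup>+ \<omega>. ennreal (x k \<omega> \<bullet> x k \<omega>) \<partial>M) \<le> (\<integral>\<^sup>+ \<omega>. ennreal (1 / p) * ennreal (quad P (x k \<omega>)) \<partial>M)"
    proof (rule nn_integral_mono)
      fix \<omega>
      have "x k \<omega> \<bullet> x k \<omega> \<le> 1 / p * quad P (x k \<omega>)"
        using p(1) p(2) [of "x k \<omega>"] by (simp add: field_simps)
      then show "ennreal (x k \<omega> \<bullet> x k \<omega>) \<le> ennreal (1 / p) * ennreal (quad P (x k \<omega>))"
        using p(1) by (simp add: ennreal_mult' [symmetric] ennreal_leI)
    qed
    also have "\<dots> = ennreal (1 / p) * (\<integral>\<^sup>+ \<omega>. ennreal (quad P (x k \<omega>)) \<partial>M)"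
      by (rule nn_integral_cmult) measurable
    also have "\<dots> \<le> ennreal (1 / p) * ennreal (q ^ k * quad P x0)"
      by (intro mult_left_mono decay) simp
    finally show ?thesis .
  qed
  have "(\<lambda>k. q ^ k * quad P x0) \<longlonglongrightarrow> 0 * quad P x0"
    using q by (intro tendsto_mult LIMSEQ_realpow_zero tendsto_const)
  then have "(\<lambda>k. ennreal (q ^ k * quad P x0)) \<longlonglongrightarrow> 0"
    using tendsto_ennrealI by fastforce
  then have "(\<lambda>k. ennreal (1 / p) * ennreal (q ^ k * quad P x0)) \<longlonglongrightarrow> ennreal (1 / p) * 0"
    by (intro ennreal_tendsto_cmult) auto
  then have lim: "(\<lambda>k. ennreal (1 / p) * ennreal (q ^ k * quad P x0)) \<longlonglongrightarrow> 0"
    by simp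
  have "(\<lambda>k. \<integral>\<^sup>+ \<omega>. ennreal (x k \<omega> \<bullet> x k \<omega>) \<partial>M) \<longlonglongrightarrow> 0"
    by (rule tendsto_sandwich [OF _ _ tendsto_const lim]) (simp_all add: bound)
  then show "(\<lambda>k. \<integral>\<^sup>+ \<omega>. ennreal (state (\<lambda>_. B) (feedback_law (lqr_gain B R P)) (\<lambda>j. A j \<omega>) x0 k
      \<bullet> state (\<lambda>_. B) (feedback_law (lqr_gain B R P)) (\<lambda>j. A j \<omega>) x0 k) \<partial>M) \<longlonglongrightarrow> 0"
    by (simp only: x_def \<psi>_def)
qed

lemma J_inf_ge:
  assumes \<psi>: "measurable_law \<psi>"
    and approx: "\<And>d. 0 < d \<Longrightarrow> \<exists>t. \<forall>v. quad P v \<le> (1 + d) * quad (value_iter t) v"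
  shows "ennreal (quad P x0) \<le> J_inf M A (\<lambda>_. B) Q R x0 \<psi>"
proof (cases "J_inf M A (\<lambda>_. B) Q R x0 \<psi>")
  case (real r)
  have "ennreal (quad (value_iter t) x0) \<le> ennreal r" for t
  proof -
    have "ennreal (quad (value_iter t) x0) \<le> J_inf M A (\<lambda>_. B) Q R x0 \<psi>"
      unfolding J_inf_eq_SUP
      by (rule SUP_upper2 [where i = t]) (simp_all only: UNIV_I finite_cost_lower_bound [OF \<psi>])
    then show ?thesis by (simp add: real)
  qed
  then have le: "quad (value_iter t) x0 \<le> r" for t
    using real(1) by (simp add: ennreal_le_iff)
  have "quad P x0 \<le> r"
  proof (rule field_le_epsilon)
    fix e :: real assume "0 < e"
    define d where "d = e / (r + 1)"
    have d: "0 < d" "d * r \<le> e"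
      using \<open>0 < e\<close> real(1) by (auto simp: d_def field_simps)
    obtain t where "quad P x0 \<le> (1 + d) * quad (value_iter t) x0"
      using approx [OF d(1)] by blast
    also have "\<dots> \<le> (1 + d) * r"
      using d(1) by (intro mult_left_mono le) simp
    also have "\<dots> \<le> r + e"
      using d(2) by (simp add: distrib_right)
    finally show "quad P x0 \<le> r + e" .
  qed
  then show ?thesis
    by (simp add: real ennreal_leI)
qed simp

end

end

theorem theorem5:
  fixes M :: "'w measure"
    and bx :: "'n::finite \<Rightarrow> 's::finite" and bu :: "'m::finite \<Rightarrow> 's"
    and A :: "nat \<Rightarrow> 'w \<Rightarrow> real^'n^'n" and Bk :: "nat \<Rightarrow> real^'m^'n"
    and Abar :: "real^'n^'n" and \<Sigma> :: "real^('n \<times> 'n)^('n \<times> 'n)" and B :: "real^'m^'n"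
    and Q :: "real^'n^'n" and R :: "real^'m^'m"
  assumes "prob_space M"
    and "surj bx" and "surj bu"
    and "\<And>k. integrable M (A k)"
    and "\<And>k. integrable M (\<lambda>\<omega>. kronecker (A k \<omega>) (A k \<omega>))"
    and "prob_space.indep_vars M (\<lambda>_. borel) (\<lambda>(k, i) \<omega>. block bx i (A k \<omega>))
           (UNIV :: (nat \<times> 's) set)"
    and "\<And>k. block_diag bx bu (Bk k)"
    and "\<And>k. integral\<^sup>L M (A k) = Abar"
    and "\<And>k. (\<integral>\<omega>. kronecker (A k \<omega>) (A k \<omega>) \<partial>M) = \<Sigma>"
    and "\<And>k. Bk k = B"
    and "ms_stabilizable M A Bk"
    and "pos_def Q"
    and "pos_def R" and "block_diag bu bu R"
  shows "\<exists>P. pos_def P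
           \<and> (\<forall>k. mdare M bx A B Q R k P)
           \<and> (\<forall>k P'. pos_def P' \<and> mdare M bx A B Q R k P' \<longrightarrow> P' = P)
           \<and> feedback_law (lqr_gain B R P) \<in> full_info_laws bu
           \<and> (\<forall>x0. \<forall>\<psi> \<in> full_info_laws bu.
                 J_inf M A Bk Q R x0 (feedback_law (lqr_gain B R P)) \<le> J_inf M A Bk Q R x0 \<psi>)
           \<and> ms_stable M A Bk (feedback_law (lqr_gain B R P))
           \<and> (\<forall>x0. (INF \<psi> \<in> full_info_laws bu. J_inf M A Bk Q R x0 \<psi>)
                     = ennreal (x0 \<bullet> (P *v x0)))"
proof -
  interpret prob_space M by fact
  interpret lqr_problem M bx A Abar \<Sigma> B Q R
    by unfold_locales (use assms in auto)
  have Bk: "Bk = (\<lambda>_. B)"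
    using assms(10) by blast
  obtain b where "\<And>t. trace (value_iter t) \<le> b"
    using trace_value_iter_bounded assms(11) unfolding Bk by blast
  then obtain P where P: "pos_def P" "riccati_step P = P"
    and approx: "\<And>d. 0 < d \<Longrightarrow> \<exists>t. \<forall>v. quad P v \<le> (1 + d) * quad (value_iter t) v"
    using fixed_point_exists by blast
  have mdare: "mdare M bx A B Q R k X \<longleftrightarrow> riccati_step X = X" for k X
    by (auto simp: mdare_iff riccati_step_def)
  have lower: "ennreal (quad P x0) \<le> J_inf M A (\<lambda>_. B) Q R x0 \<psi>" if "\<psi> \<in> full_info_laws bu" for x0 \<psi>
    using J_inf_ge [OF P _ approx] that by (simp add: full_info_laws_iff)
  have law: "feedback_law (lqr_gain B R P) \<in> full_info_laws bu"
    by (simp add: full_info_laws_iff measurable_law_lqr)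
  have "(INF \<psi> \<in> full_info_laws bu. J_inf M A (\<lambda>_. B) Q R x0 \<psi>) = ennreal (quad P x0)" for x0
    by (intro antisym INF_lower2 [OF law] INF_greatest lower J_inf_lqr_le P)
  moreover have "X = P" if "pos_def X" "riccati_step X = X" for X
    using fixed_point_unique [OF _ P(2) _ that(2)] P(1) that(1) by (simp add: pos_def_imp_pos_semidef)
  ultimately show ?thesis
    unfolding Bk mdare
    using P law ms_stable_lqr [OF P] order_trans [OF J_inf_lqr_le [OF P] lower] by blast
qed

end
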